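(* There is a function $c(k)$, defined for integers $k\ge 2$ and satisfying $$c(k) = \exp\big(2k \log\log k + O(k)\big)$$ (with an absolute implied constant), such that for every fixed integer $k\ge 2$, as $q \to \infty$ through the primes, $$\frac{1}{\phi(q)} \sum_{\substack{\chi \bmod q\\ \chi \ne \chi_0}} M(\chi)^{2k} \ge \big(c(k) + o(1)\big)\, q^k ,$$ where, for each fixed $k$, the $o(1)$ term tends to $0$ as $q\to\infty$.
   Context: For a Dirichlet character $\chi$ modulo $q$, let $S_\chi(t) = \sum_{1\le n \le t}\chi(n)$ and $M(\chi) = \max_{t} |S_\chi(t)|$. The sum runs over all nonprincipal Dirichlet characters modulo $q$; $\chi_0$ denotes the principal character modulo $q$ and $\phi$ is Euler's function. *)

theory Defs
  imports Complex_Main "HOL-Number_Theory.Totient"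
begin

definition dirichlet_characters :: "nat \<Rightarrow> (int \<Rightarrow> complex) set" where
  "dirichlet_characters q =
     {\<chi>. (\<forall>a b. \<chi> (a * b) = \<chi> a * \<chi> b) \<and>
          (\<forall>a. \<chi> (a + int q) = \<chi> a) \<and>
          (\<forall>a. \<chi> a \<noteq> 0 \<longleftrightarrow> coprime a (int q))}"

definition principal_character :: "nat \<Rightarrow> int \<Rightarrow> complex" where
  "principal_character q = (\<lambda>a. if coprime a (int q) then 1 else 0)"

definition char_sum :: "(int \<Rightarrow> complex) \<Rightarrow> real \<Rightarrow> complex" where
  "char_sum \<chi> t = (\<Sum>n | 1 \<le> n \<and> real n \<le> t. \<chi> (int n))"

text \<open>
  For a nonprincipal character the partial sums are periodic in the cutoff, so the
  set below is finite and its maximum is meaningful. For the principal character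
  the set is infinite and the value of \<open>Max\<close> is unspecified.
\<close>
definition max_char_sum :: "(int \<Rightarrow> complex) \<Rightarrow> real" where
  "max_char_sum \<chi> = Max (range (\<lambda>t::real. cmod (char_sum \<chi> t)))"

end

theory Submission
  imports
    Defs
    "HOL-Analysis.Convex"
    "HOL-Number_Theory.Number_Theory"
    "HOL-Real_Asymp.Real_Asymp"
begin

text \<open>
  For nonprincipal \<open>\<chi>\<close>, expanding \<open>\<chi>\<close> in additive characters turns \<open>\<Sum>n. n \<chi>(n)\<close> into a Gauss sum
  times \<open>L(\<chi>) = \<Sum>m. \<chi>(m) cot(\<pi>m/q) / (2q)\<close>, and partial summation then gives
  \<open>M(\<chi>) \<ge> \<surd>q \<bar>L(\<chi>)\<bar>\<close>. Since the weights are odd, \<open>L\<close> vanishes at the principal character.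

  The moments of \<open>L\<close> are compared with those of \<open>A(\<chi>) = \<Sum>m\<le>k. \<chi>(m)/m\<close>: by orthogonality the mean
  of \<open>\<bar>A\<bar>^(2k)\<close> is eventually \<open>D = \<Sum>n. f(n)^2\<close>, where \<open>f(n)\<close> are the coefficients of \<open>A^k\<close>, while
  the correlation of \<open>L A^(k-1)\<close> with \<open>A^k\<close> tends to at least \<open>D / (2\<pi>)\<close>, as the weights at fixed \<open>m\<close>
  tend to \<open>1 / (2\<pi>m)\<close>. So the mean of \<open>\<bar>4\<pi>L\<bar>^(2k)\<close> is eventually at least \<open>D\<close>.

  Finally \<open>f\<close> has total mass \<open>(\<Sum>m\<le>k. 1/m)^k \<ge> (log k)^k\<close> and is supported on the products of \<open>k\<close>
  numbers from \<open>{1..k}\<close>, of which there are at most \<open>4^k\<close> since the order of the factors is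
  irrelevant. By Cauchy--Schwarz \<open>D \<ge> (log k)^(2k) / 4^k\<close>, so \<open>c(k) = (log k / (8\<pi>))^(2k)\<close> works.
\<close>

section \<open>Dirichlet characters to a prime modulus\<close>

lemma
  assumes "\<chi> \<in> dirichlet_characters q"
  shows dchar_mult: "\<chi> (a * b) = \<chi> a * \<chi> b"
    and dchar_add_modulus: "\<chi> (a + int q) = \<chi> a"
    and dchar_eq_0_iff: "\<chi> a = 0 \<longleftrightarrow> \<not> coprime a (int q)"
  using assms by (auto simp: dirichlet_characters_def)

lemma dchar_1:
  assumes "\<chi> \<in> dirichlet_characters q"
  shows "\<chi> 1 = 1"
  using dchar_mult[OF assms, of 1 1] dchar_eq_0_iff[OF assms, of 1] by simp

lemma dchar_power:
  assumes "\<chi> \<in> dirichlet_characters q"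
  shows "\<chi> (a ^ n) = \<chi> a ^ n"
  by (induction n) (simp_all add: dchar_1[OF assms] dchar_mult[OF assms])

text \<open>The definition grants only the single shift by \<open>q\<close>. Iterating it covers
  nonnegative multiples; a negative multiple is undone starting from the shifted point.\<close>

lemma dchar_cong:
  assumes "\<chi> \<in> dirichlet_characters q" and "[a = b] (mod int q)"
  shows "\<chi> a = \<chi> b"
proof -
  have plus: "\<chi> (c + int q * int n) = \<chi> c" for c n
  proof (induction n)
    case (Suc n)
    have "\<chi> (c + int q * int (Suc n)) = \<chi> ((c + int q * int n) + int q)"
      by (simp add: algebra_simps)
    then show ?case
      using Suc dchar_add_modulus[OF assms(1)] by simp
  qed simp
  have mult: "\<chi> (c + int q * d) = \<chi> c" for c d
  proof (cases "d \<ge> 0")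
    case True
    then show ?thesis using plus[of c "nat d"] by simp
  next
    case False
    then show ?thesis using plus[of "c + int q * d" "nat (- d)"] by simp
  qed
  obtain k where "b = a + int q * k"
    using assms(2) cong_iff_lin by blast
  then show ?thesis using mult by simp
qed

text \<open>By Euler's theorem the value is a root of unity. The least residue \<open>b\<close>
  carries the argument over to natural numbers.\<close>

lemma norm_dchar:
  assumes "prime q" and "\<chi> \<in> dirichlet_characters q" and "coprime a (int q)"
  shows "norm (\<chi> a) = 1"
proof -
  define b where "b = nat (a mod int q)"
  have q: "q > 1" using assms(1) prime_gt_1_nat by blast
  have b: "int b = a mod int q" using q by (simp add: b_def)
  have cong: "[a = int b] (mod int q)" unfolding b by (simp add: Cong.cong_def)
  have "coprime (int b) (int q)"
    using cong assms(3) cong_imp_coprime by blast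
  then have "[b ^ totient q = 1] (mod q)"
    using euler_theorem by simp
  then have "[int b ^ totient q = 1] (mod int q)"
    by (metis cong_int_iff of_nat_power of_nat_1)
  then have "\<chi> (int b) ^ totient q = 1"
    using dchar_cong[OF assms(2)] dchar_1[OF assms(2)] dchar_power[OF assms(2)] by metis
  then have "norm (\<chi> (int b)) ^ totient q = 1"
    by (metis norm_one norm_power)
  moreover have "totient q > 0" using q by simp
  ultimately have "norm (\<chi> (int b)) = 1"
    by (metis norm_ge_zero power_eq_1_iff order_less_irrefl real_norm_def abs_norm_cancel)
  then show ?thesis using dchar_cong[OF assms(2) cong] by simp
qed

lemma dchar_times_cnj:
  assumes "prime q" and "\<chi> \<in> dirichlet_characters q" and "coprime a (int q)"
  shows "\<chi> a * cnj (\<chi> a) = 1"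
  using norm_dchar[OF assms] by (simp add: complex_norm_square[symmetric])

lemma dchar_times:
  assumes "\<chi> \<in> dirichlet_characters q" and "\<psi> \<in> dirichlet_characters q"
  shows "(\<lambda>a. \<chi> a * \<psi> a) \<in> dirichlet_characters q"
  using assms by (simp add: dirichlet_characters_def)

lemma principal_character_in_dirichlet_characters:
  "principal_character q \<in> dirichlet_characters q"
proof -
  have "coprime (a + int q) (int q) \<longleftrightarrow> coprime a (int q)" for a
    by (metis coprime_iff_gcd_eq_1 gcd_add1)
  then show ?thesis
    by (auto simp: dirichlet_characters_def principal_character_def)
qed

lemma coprime_int_prime:
  assumes "prime q" and "m \<in> {1..<int q}"
  shows "coprime m (int q)"
proof -
  have "\<not> int q dvd m" using assms(2) zdvd_not_zless by auto
  then show ?thesis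
    using assms(1) by (metis coprime_commute prime_imp_coprime prime_nat_int_transfer)
qed

section \<open>Characters as roots of unity, through a primitive root\<close>

lemma primroot_power_exists:
  assumes "prime q" and "residue_primroot q g" and "coprime a (int q)"
  obtains i where "i < q - 1" and "[a = int g ^ i] (mod int q)"
proof -
  define b where "b = nat (a mod int q)"
  have q: "q > 1" using assms(1) prime_gt_1_nat by blast
  have b: "int b = a mod int q" using q by (simp add: b_def)
  have cong: "[a = int b] (mod int q)" unfolding b by (simp add: Cong.cong_def)
  have "coprime (int b) (int q)"
    using cong assms(3) cong_imp_coprime by blast
  then have "coprime b q" by simp
  moreover have "b < q" using b q by (metis of_nat_less_iff pos_mod_bound of_nat_0_less_iff less_trans zero_less_one)
  moreover have "b \<noteq> 0" using \<open>coprime b q\<close> q by (auto intro: ccontr)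
  ultimately have "b \<in> totatives q" by (simp add: in_totatives_iff)
  then obtain i where "i < totient q" "b = g ^ i mod q"
    using residue_primroot_is_generator[OF q assms(2)] by (auto simp: bij_betw_def)
  moreover from this have "[b = g ^ i] (mod q)" by (simp add: Cong.cong_def)
  then have "[int b = int g ^ i] (mod int q)"
    by (metis cong_int_iff of_nat_power of_nat_1)
  ultimately show thesis
    using that cong totient_prime[OF assms(1)] cong_trans by metis
qed

text \<open>Since \<open>g\<close> generates the units, a character is determined by its value at
  \<open>g\<close>, a \<open>(q - 1)\<close>-th root of unity; conversely every such root extends
  along the discrete logarithm. This counts the characters and supplies one that separates two given
  units.\<close>

lemma bij_betw_dchar_primroot:
  assumes "prime q" and "residue_primroot q g"
  shows "bij_betw (\<lambda>\<chi>. \<chi> (int g)) (dirichlet_characters q) {z. z ^ (q - 1) = 1}"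
  unfolding bij_betw_def
proof
  have q: "q > 1" using assms(1) prime_gt_1_nat by blast
  have g: "coprime q g" "ord q g = q - 1"
    using assms(2) totient_prime[OF assms(1)] by (auto simp: residue_primroot_def)
  show "inj_on (\<lambda>\<chi>. \<chi> (int g)) (dirichlet_characters q)"
  proof (rule inj_onI)
    fix \<chi> \<psi>
    assume D: "\<chi> \<in> dirichlet_characters q" "\<psi> \<in> dirichlet_characters q" "\<chi> (int g) = \<psi> (int g)"
    show "\<chi> = \<psi>"
    proof
      fix a
      show "\<chi> a = \<psi> a"
      proof (cases "coprime a (int q)")
        case True
        then obtain i where i: "[a = int g ^ i] (mod int q)"
          using primroot_power_exists[OF assms] by blast
        have "\<chi> a = \<chi> (int g) ^ i" "\<psi> a = \<psi> (int g) ^ i"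
          using dchar_cong[OF D(1) i] dchar_cong[OF D(2) i] dchar_power[OF D(1)] dchar_power[OF D(2)]
          by simp_all
        then show ?thesis using D(3) by simp
      next
        case False
        then show ?thesis using dchar_eq_0_iff[OF D(1)] dchar_eq_0_iff[OF D(2)] by metis
      qed
    qed
  qed
  show "(\<lambda>\<chi>. \<chi> (int g)) ` dirichlet_characters q = {z. z ^ (q - 1) = 1}"
  proof (intro equalityI subsetI)
    fix z assume "z \<in> (\<lambda>\<chi>. \<chi> (int g)) ` dirichlet_characters q"
    then obtain \<chi> where \<chi>: "\<chi> \<in> dirichlet_characters q" "z = \<chi> (int g)" by auto
    have "[g ^ (q - 1) = 1] (mod q)" using g(2) ord[of g q] by simp
    then have "[int g ^ (q - 1) = 1] (mod int q)"
      by (metis cong_int_iff of_nat_power of_nat_1)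
    then show "z \<in> {z. z ^ (q - 1) = 1}"
      using dchar_cong[OF \<chi>(1)] dchar_1[OF \<chi>(1)] dchar_power[OF \<chi>(1)] \<chi>(2) by fastforce
  next
    fix z :: complex assume "z \<in> {z. z ^ (q - 1) = 1}"
    then have z: "z ^ (q - 1) = 1" by simp
    \<comment> \<open>A discrete logarithm to base \<open>g\<close>. It is determined only modulo
      \<open>q - 1\<close>, which suffices because \<open>z ^ (q - 1) = 1\<close>.\<close>
    define l where "l a = (SOME i. [a = int g ^ i] (mod int q))" for a
    have l: "[a = int g ^ l a] (mod int q)" if "coprime a (int q)" for a
      unfolding l_def using primroot_power_exists[OF assms that] someI_ex by metis
    have l_eq: "z ^ l a = z ^ i" if "[a = int g ^ i] (mod int q)" "coprime a (int q)" for a i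
    proof -
      have "[int g ^ l a = int g ^ i] (mod int q)"
        using l[OF that(2)] that(1) cong_sym cong_trans by blast
      then have "[g ^ l a = g ^ i] (mod q)" by (metis cong_int_iff of_nat_power)
      then have "[l a = i] (mod (q - 1))" using order_divides_expdiff[OF g(1)] g(2) by simp
      moreover have red: "z ^ j = z ^ (j mod (q - 1))" for j
      proof -
        have "z ^ j = z ^ ((q - 1) * (j div (q - 1)) + j mod (q - 1))" by simp
        also have "\<dots> = z ^ (j mod (q - 1))" using z by (simp only: power_add power_mult) simp
        finally show ?thesis .
      qed
      ultimately show ?thesis using red[of "l a"] red[of i] unfolding Cong.cong_def by metis
    qed
    define \<chi> where "\<chi> a = (if coprime a (int q) then z ^ l a else 0)" for a
    have "z \<noteq> 0" using z q by (intro notI) (simp add: power_0_left)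
    then have nz: "\<chi> a \<noteq> 0 \<longleftrightarrow> coprime a (int q)" for a by (simp add: \<chi>_def)
    have "\<chi> (a + int q) = \<chi> a" for a
    proof -
      have co: "coprime (a + int q) (int q) \<longleftrightarrow> coprime a (int q)"
        by (metis coprime_iff_gcd_eq_1 gcd_add1)
      have "z ^ l (a + int q) = z ^ l a" if "coprime a (int q)"
      proof (rule l_eq)
        have "[a + int q = a] (mod int q)" by (simp add: Cong.cong_def)
        then show "[a + int q = int g ^ l a] (mod int q)" using l[OF that] cong_trans by blast
      qed (use that co in simp)
      then show ?thesis using co by (simp add: \<chi>_def)
    qed
    moreover have "\<chi> (a * b) = \<chi> a * \<chi> b" for a b
    proof -
      have "z ^ l (a * b) = z ^ (l a + l b)" if "coprime a (int q)" "coprime b (int q)"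
        by (rule l_eq) (use cong_mult[OF l[OF that(1)] l[OF that(2)]] that in \<open>auto simp: power_add\<close>)
      then show ?thesis by (auto simp: \<chi>_def power_add)
    qed
    ultimately have "\<chi> \<in> dirichlet_characters q" using nz by (simp add: dirichlet_characters_def)
    moreover have "\<chi> (int g) = z"
      using l_eq[of "int g" 1] g(1) by (simp add: \<chi>_def coprime_commute)
    ultimately show "z \<in> (\<lambda>\<chi>. \<chi> (int g)) ` dirichlet_characters q" by force
  qed
qed

lemma
  assumes "prime q"
  shows finite_dirichlet_characters: "finite (dirichlet_characters q)"
    and card_dirichlet_characters: "card (dirichlet_characters q) = q - 1"
proof -
  obtain g where g: "residue_primroot q g" using prime_primitive_root_exists[OF prime_gt_1_nat[OF assms] assms] by blast
  have q: "q - 1 > 0" using assms prime_gt_1_nat by simp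
  have "finite {z::complex. z ^ (q - 1) = 1}" "card {z::complex. z ^ (q - 1) = 1} = q - 1"
    using q by (auto intro!: finite_roots_unity card_roots_unity_eq)
  then show "finite (dirichlet_characters q)" "card (dirichlet_characters q) = q - 1"
    using bij_betw_dchar_primroot[OF assms g] bij_betw_finite bij_betw_same_card by metis+
qed

section \<open>Orthogonality of characters\<close>

lemma dchar_separates:
  assumes "prime q" and "coprime a (int q)" and "coprime b (int q)" and "\<not> [a = b] (mod int q)"
  obtains \<psi> where "\<psi> \<in> dirichlet_characters q" and "\<psi> a \<noteq> \<psi> b"
proof -
  obtain g where g: "residue_primroot q g" using prime_primitive_root_exists[OF prime_gt_1_nat[OF assms(1)] assms(1)] by blast
  obtain i where i: "i < q - 1" "[a = int g ^ i] (mod int q)"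
    using primroot_power_exists[OF assms(1) g assms(2)] .
  obtain j where j: "j < q - 1" "[b = int g ^ j] (mod int q)"
    using primroot_power_exists[OF assms(1) g assms(3)] .
  have ij: "i \<noteq> j" using assms(4) i(2) j(2) cong_sym cong_trans by blast
  \<comment> \<open>The powers of this primitive \<open>(q - 1)\<close>-th root of unity with
    exponents below \<open>q - 1\<close> are distinct, so the character taking the value
    \<open>\<omega>\<close> at \<open>g\<close> separates \<open>g ^ i\<close> from
    \<open>g ^ j\<close>.\<close>
  define \<omega> where "\<omega> = cis (2 * pi / real (q - 1))"
  have pow: "\<omega> ^ n = cis (2 * pi * real n / real (q - 1))" for n
    by (simp add: \<omega>_def DeMoivre mult_ac)
  have q: "q - 1 > 0" using i by simp
  have "\<omega> ^ i \<noteq> \<omega> ^ j"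
    using bij_betw_roots_unity[OF q] i(1) j(1) ij unfolding bij_betw_def inj_on_def pow by blast
  moreover have "\<omega> \<in> (\<lambda>\<chi>. \<chi> (int g)) ` dirichlet_characters q"
    unfolding bij_betw_imp_surj_on[OF bij_betw_dchar_primroot[OF assms(1) g]] mem_Collect_eq pow
    using q by simp
  then obtain \<psi> where \<psi>: "\<psi> \<in> dirichlet_characters q" "\<psi> (int g) = \<omega>"
    by (elim imageE) simp
  moreover have "\<psi> a = \<omega> ^ i" "\<psi> b = \<omega> ^ j"
    using dchar_cong[OF \<psi>(1) i(2)] dchar_cong[OF \<psi>(1) j(2)] dchar_power[OF \<psi>(1)] \<psi>(2) by simp_all
  ultimately show thesis using that by metis
qed

lemma dchar_orthogonality:
  assumes "prime q" and "coprime a (int q)" and "coprime b (int q)"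
  shows "(\<Sum>\<chi>\<in>dirichlet_characters q. \<chi> a * cnj (\<chi> b)) =
         (if [a = b] (mod int q) then of_nat (q - 1) else 0)"
proof (cases "[a = b] (mod int q)")
  case True
  have "\<chi> a * cnj (\<chi> b) = 1" if "\<chi> \<in> dirichlet_characters q" for \<chi>
    using dchar_cong[OF that True] dchar_times_cnj[OF assms(1) that assms(3)] by simp
  then show ?thesis using True card_dirichlet_characters[OF assms(1)] by simp
next
  case False
  define D where "D = dirichlet_characters q"
  obtain \<psi> where \<psi>: "\<psi> \<in> D" "\<psi> a \<noteq> \<psi> b"
    using dchar_separates[OF assms False] D_def by blast
  \<comment> \<open>Multiplication by \<open>\<psi>\<close> permutes the characters; it is injective
    because \<open>\<psi>\<close> vanishes only where every character does. Hence the sum is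
    unchanged by the factor \<open>\<psi> a * cnj (\<psi> b)\<close>, which is not 1.\<close>
  have "inj_on (\<lambda>\<chi> c. \<psi> c * \<chi> c) D"
  proof (rule inj_onI)
    fix \<chi> \<chi>' assume *: "\<chi> \<in> D" "\<chi>' \<in> D" "(\<lambda>c. \<psi> c * \<chi> c) = (\<lambda>c. \<psi> c * \<chi>' c)"
    show "\<chi> = \<chi>'"
    proof
      fix c
      show "\<chi> c = \<chi>' c"
        using fun_cong[OF *(3), of c] * \<psi>(1) dchar_eq_0_iff[of _ q c] unfolding D_def
        by (metis mult_left_cancel)
    qed
  qed
  moreover have "(\<lambda>\<chi> c. \<psi> c * \<chi> c) ` D \<subseteq> D"
    using \<psi>(1) dchar_times unfolding D_def by blast
  moreover have "finite D" using finite_dirichlet_characters[OF assms(1)] D_def by simp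
  ultimately have bij: "bij_betw (\<lambda>\<chi> c. \<psi> c * \<chi> c) D D"
    by (simp add: bij_betw_def endo_inj_surj)
  define S where "S = (\<Sum>\<chi>\<in>D. \<chi> a * cnj (\<chi> b))"
  have "S = (\<Sum>\<chi>\<in>D. (\<psi> a * \<chi> a) * cnj (\<psi> b * \<chi> b))"
    unfolding S_def by (rule sum.reindex_bij_betw[OF bij, symmetric])
  also have "\<dots> = \<psi> a * cnj (\<psi> b) * S"
    by (simp add: S_def sum_distrib_left mult_ac)
  finally have "(1 - \<psi> a * cnj (\<psi> b)) * S = 0" by (simp add: algebra_simps)
  moreover have "\<psi> a * cnj (\<psi> b) \<noteq> 1"
  proof
    assume "\<psi> a * cnj (\<psi> b) = 1"
    moreover have "\<psi> b * cnj (\<psi> b) = 1"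
      using dchar_times_cnj[OF assms(1) _ assms(3)] \<psi>(1) D_def by simp
    ultimately show False
      using \<psi>(2) by (metis mult_cancel_right mult_zero_right zero_neq_one)
  qed
  ultimately show ?thesis using False by (simp add: S_def D_def)
qed

section \<open>Complete sums over the residues\<close>

lemma sum_residues_mult:
  fixes h :: "int \<Rightarrow> 'a::comm_monoid_add"
  assumes "coprime b n" and "\<And>m. h (m mod n) = h m"
  shows "(\<Sum>m\<in>{1..<n}. h (b * m)) = (\<Sum>m\<in>{1..<n}. h m)"
proof -
  have "(\<Sum>m\<in>{1..<n}. h (b * m)) = (\<Sum>m\<in>{1..<n}. h (b * m mod n))"
    using assms(2) by simp
  also have "\<dots> = (\<Sum>m\<in>{1..<n}. h m)"
    by (rule sum.reindex_bij_betw[OF bij_betw_int_remainders_mult[OF assms(1)]])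
  finally show ?thesis .
qed

lemma dchar_mod:
  assumes "\<chi> \<in> dirichlet_characters q"
  shows "\<chi> (a mod int q) = \<chi> a"
  by (rule dchar_cong[OF assms]) (simp add: Cong.cong_def)

text \<open>Multiplication by a unit \<open>b\<close> with \<open>\<chi> b \<noteq> 1\<close>
  permutes the nonzero residues, so the sum is unchanged by the factor
  \<open>\<chi> b\<close>.\<close>

lemma sum_nonprincipal:
  assumes "\<chi> \<in> dirichlet_characters q" and "\<chi> \<noteq> principal_character q"
  shows "(\<Sum>m\<in>{1..<int q}. \<chi> m) = 0"
proof -
  obtain b where b: "\<chi> b \<noteq> principal_character q b" using assms(2) by blast
  then have co: "coprime b (int q)" and b1: "\<chi> b \<noteq> 1"
    using dchar_eq_0_iff[OF assms(1)] unfolding principal_character_def by metis+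
  have "\<chi> b * (\<Sum>m\<in>{1..<int q}. \<chi> m) = (\<Sum>m\<in>{1..<int q}. \<chi> (b * m))"
    by (simp add: sum_distrib_left dchar_mult[OF assms(1)])
  also have "\<dots> = (\<Sum>m\<in>{1..<int q}. \<chi> m)"
    by (rule sum_residues_mult[OF co]) (rule dchar_mod[OF assms(1)])
  finally show ?thesis using b1 by simp
qed

section \<open>Gauss sums and the cotangent expansion\<close>

definition unit_exp :: "nat \<Rightarrow> int \<Rightarrow> complex" where
  "unit_exp q x = cis (2 * pi * real_of_int x / real q)"

lemma unit_exp_power: "unit_exp q m ^ n = unit_exp q (m * int n)"
  by (simp add: unit_exp_def DeMoivre mult_ac)

lemma cnj_unit_exp: "cnj (unit_exp q x) = unit_exp q (- x)"
  by (simp add: unit_exp_def cis_cnj)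

lemma unit_exp_add: "unit_exp q (x + y) = unit_exp q x * unit_exp q y"
  by (simp add: unit_exp_def cis_mult add_divide_distrib ring_distribs)

lemma unit_exp_multiple:
  assumes "q > 0"
  shows "unit_exp q (int q * k) = 1"
proof -
  have "2 * pi * real_of_int (int q * k) / real q = 2 * pi * real_of_int k"
    using assms by simp
  then show ?thesis unfolding unit_exp_def by (simp only: cis_multiple_2pi Ints_of_int)
qed

lemma unit_exp_mod:
  assumes "q > 0"
  shows "unit_exp q (x mod int q) = unit_exp q x"
proof -
  have "unit_exp q x = unit_exp q (int q * (x div int q) + x mod int q)" by simp
  then show ?thesis using unit_exp_add unit_exp_multiple[OF assms] by (metis mult_1)
qed

lemma unit_exp_eq_1_iff:
  assumes "q > 0"
  shows "unit_exp q x = 1 \<longleftrightarrow> int q dvd x"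
proof
  assume "unit_exp q x = 1"
  then have "cos (2 * pi * real_of_int x / real q) = 1"
    by (simp add: unit_exp_def complex_eq_iff)
  then obtain n :: int where "2 * pi * real_of_int x / real q = real_of_int n * 2 * pi"
    using cos_one_2pi_int by blast
  then have "real_of_int x = real_of_int (n * int q)"
    using assms by (simp add: field_simps)
  then show "int q dvd x" by (metis dvd_triv_right of_int_eq_iff)
next
  assume "int q dvd x"
  then show "unit_exp q x = 1" using unit_exp_multiple[OF assms] by (auto elim: dvdE)
qed

lemma sum_unit_exp:
  assumes "q > 0"
  shows "(\<Sum>n<q. unit_exp q (m * int n)) = (if int q dvd m then of_nat q else 0)"
proof (cases "int q dvd m")
  case True
  then have "unit_exp q m = 1" using unit_exp_eq_1_iff[OF assms] by blast
  then show ?thesis using True by (simp flip: unit_exp_power)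
next
  case False
  then have "unit_exp q m \<noteq> 1" using unit_exp_eq_1_iff[OF assms] by blast
  moreover have "unit_exp q m ^ q = 1"
    unfolding unit_exp_power using unit_exp_multiple[OF assms] by (simp add: mult.commute)
  ultimately show ?thesis
    using False by (simp add: geometric_sum flip: unit_exp_power)
qed

section \<open>Weighted geometric sums and the cotangent\<close>

lemma sum_index_times_power:
  fixes z :: "'a::field"
  assumes "z ^ q = 1" and "z \<noteq> 1"
  shows "(\<Sum>n<q. of_nat n * z ^ n) = of_nat q / (z - 1)"
proof -
  \<comment> \<open>The identity is stated for every cutoff \<open>N\<close> so that induction
    applies; at \<open>N = q\<close> the geometric sum on the right vanishes.\<close>
  have "(z - 1) * (\<Sum>n<N. of_nat n * z ^ n) = of_nat N * z ^ N - z * (\<Sum>n<N. z ^ n)" for N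
    by (induction N) (simp_all add: algebra_simps)
  then have "(z - 1) * (\<Sum>n<q. of_nat n * z ^ n) = of_nat q"
    using assms by (simp add: geometric_sum)
  then show ?thesis using assms(2) by (simp add: field_simps)
qed

text \<open>The left side is exp(-it) / (2i sin t). Its constant real part disappears after
  summation against a nonprincipal character, so that only the cotangent survives.\<close>

lemma inverse_cis_minus_1:
  assumes "sin t \<noteq> 0"
  shows "1 / (cis (2 * t) - 1) = - 1 / 2 - \<i> / 2 * complex_of_real (cot t)"
proof -
  have "cos t * cos t + sin t * sin t = 1"
    using sin_cos_squared_add3[of t] .
  then have "(cis (2 * t) - 1) * (- 1 / 2 - \<i> / 2 * complex_of_real (cot t)) = 1"
    using assms
    by (simp add: complex_eq_iff cot_def sin_double cos_double_sin) (simp add: field_simps power2_eq_square)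
  then show ?thesis by (metis mult_eq_0_iff nonzero_eq_divide_eq mult.commute zero_neq_one)
qed

text \<open>Normalised so that the weight at a fixed \<open>m > 0\<close> tends to
  \<open>1 / (2 * pi * m)\<close>.\<close>

definition cot_weight :: "nat \<Rightarrow> int \<Rightarrow> real" where
  "cot_weight q m = cot (pi * real_of_int m / real q) / (2 * real q)"

text \<open>For an odd character modulo a prime \<open>q\<close> this is L(1,\<chi>) / \<pi>; for an
  even one it is 0.\<close>

definition cot_sum :: "nat \<Rightarrow> (int \<Rightarrow> complex) \<Rightarrow> complex" where
  "cot_sum q \<chi> = (\<Sum>m\<in>{1..<int q}. \<chi> m * complex_of_real (cot_weight q m))"

definition gauss_sum :: "nat \<Rightarrow> (int \<Rightarrow> complex) \<Rightarrow> complex" where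
  "gauss_sum q \<chi> = (\<Sum>m\<in>{1..<int q}. \<chi> m * unit_exp q m)"

lemma sin_fraction_pos:
  assumes "m \<in> {1..<int q}"
  shows "sin (pi * real_of_int m / real q) > 0"
  using assms by (intro sin_gt_zero) (auto simp: field_simps)

text \<open>For \<open>n\<close> prime to \<open>q\<close>, reindexing by \<open>n * m\<close> pulls
  out the factor. For \<open>n = 0\<close> the left side vanishes because \<open>\<chi>\<close> is
  nonprincipal, the right side because \<open>\<chi> 0 = 0\<close>.\<close>

lemma twisted_gauss_sum:
  assumes "prime q" and "\<chi> \<in> dirichlet_characters q" and "\<chi> \<noteq> principal_character q" and "n < q"
  shows "(\<Sum>m\<in>{1..<int q}. \<chi> m * unit_exp q (m * int n)) = cnj (\<chi> (int n)) * gauss_sum q \<chi>"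
proof (cases "n = 0")
  case True
  have "\<chi> 0 = 0" using dchar_eq_0_iff[OF assms(2), of 0] assms(1) by auto
  then show ?thesis
    using True sum_nonprincipal[OF assms(2,3)] by (simp add: unit_exp_def)
next
  case False
  have q: "q > 0" using assms(4) by simp
  have co: "coprime (int n) (int q)"
    by (rule coprime_int_prime[OF assms(1)]) (use False assms(4) in auto)
  have "\<chi> m * unit_exp q (m * int n) = cnj (\<chi> (int n)) * (\<chi> (int n * m) * unit_exp q (int n * m))" for m
  proof -
    have "\<chi> m * unit_exp q (m * int n) = (\<chi> (int n) * cnj (\<chi> (int n))) * (\<chi> m * unit_exp q (m * int n))"
      using dchar_times_cnj[OF assms(1,2) co] by simp
    then show ?thesis by (simp add: dchar_mult[OF assms(2)] mult_ac)
  qed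
  then have "(\<Sum>m\<in>{1..<int q}. \<chi> m * unit_exp q (m * int n)) =
      cnj (\<chi> (int n)) * (\<Sum>m\<in>{1..<int q}. \<chi> (int n * m) * unit_exp q (int n * m))"
    by (simp only: sum_distrib_left)
  also have "(\<Sum>m\<in>{1..<int q}. \<chi> (int n * m) * unit_exp q (int n * m)) = gauss_sum q \<chi>"
    unfolding gauss_sum_def using sum_residues_mult[OF co, of "\<lambda>m. \<chi> m * unit_exp q m"]
    by (simp add: dchar_mod[OF assms(2)] unit_exp_mod[OF q])
  finally show ?thesis .
qed

lemma sum_norm_dchar_squared:
  assumes "prime q" and "\<chi> \<in> dirichlet_characters q"
  shows "(\<Sum>m\<in>{1..<int q}. \<chi> m * cnj (\<chi> m)) = of_nat (q - 1)"
proof -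
  have "(\<Sum>m\<in>{1..<int q}. \<chi> m * cnj (\<chi> m)) = (\<Sum>m\<in>{1..<int q}. 1)"
    by (intro sum.cong refl dchar_times_cnj[OF assms] coprime_int_prime[OF assms(1)])
  then show ?thesis by (simp add: nat_diff_distrib)
qed

text \<open>Parseval's identity, applied to \<open>\<chi>\<close> on the residues modulo \<open>q\<close>.\<close>

lemma norm_gauss_sum:
  assumes "prime q" and "\<chi> \<in> dirichlet_characters q" and "\<chi> \<noteq> principal_character q"
  shows "norm (gauss_sum q \<chi>) = sqrt (real q)"
proof -
  have q: "q > 1" using assms(1) prime_gt_1_nat by blast
  then have q0: "q > 0" by simp
  define G where "G n = (\<Sum>m\<in>{1..<int q}. \<chi> m * unit_exp q (m * int n))" for n
  let ?\<tau> = "gauss_sum q \<chi>"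
  have "(\<Sum>n<q. \<chi> (int n) * cnj (\<chi> (int n))) = (\<Sum>m\<in>{1..<int q}. \<chi> m * cnj (\<chi> m))"
  proof -
    have "\<chi> 0 = 0" using dchar_eq_0_iff[OF assms(2), of 0] q by auto
    then have "(\<Sum>n<q. \<chi> (int n) * cnj (\<chi> (int n))) = (\<Sum>n\<in>{1..<q}. \<chi> (int n) * cnj (\<chi> (int n)))"
      by (intro sum.mono_neutral_right) (auto simp: Suc_le_eq)
    also have "\<dots> = (\<Sum>m\<in>{1..<int q}. \<chi> m * cnj (\<chi> m))"
      by (rule sum.reindex_bij_witness[of _ nat int]) auto
    finally show ?thesis .
  qed
  then have norm_chi: "(\<Sum>n<q. \<chi> (int n) * cnj (\<chi> (int n))) = of_nat (q - 1)"
    using sum_norm_dchar_squared[OF assms(1,2)] by simp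
  \<comment> \<open>The sum of the squared norms of \<open>G\<close> is evaluated twice: here
    through the twisted Gauss sums, below through orthogonality of the additive characters, which
    gives \<open>q * (q - 1)\<close>.\<close>
  have "(\<Sum>n<q. G n * cnj (G n)) = (\<Sum>n<q. (?\<tau> * cnj ?\<tau>) * (\<chi> (int n) * cnj (\<chi> (int n))))"
    using twisted_gauss_sum[OF assms] by (intro sum.cong) (simp_all add: G_def mult_ac)
  also have "\<dots> = ?\<tau> * cnj ?\<tau> * of_nat (q - 1)"
    by (simp only: norm_chi flip: sum_distrib_left)
  finally have 1: "(\<Sum>n<q. G n * cnj (G n)) = ?\<tau> * cnj ?\<tau> * of_nat (q - 1)" .
  have "(\<Sum>n<q. G n * cnj (G n)) =
      (\<Sum>n<q. \<Sum>m\<in>{1..<int q}. \<Sum>l\<in>{1..<int q}. \<chi> m * cnj (\<chi> l) * unit_exp q ((m - l) * int n))"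
    unfolding G_def cnj_sum sum_product
    by (intro sum.cong refl) (simp add: cnj_unit_exp left_diff_distrib unit_exp_add[of q "_ * _" "- _", simplified])
  also have "\<dots> = (\<Sum>m\<in>{1..<int q}. \<Sum>l\<in>{1..<int q}. \<Sum>n<q. \<chi> m * cnj (\<chi> l) * unit_exp q ((m - l) * int n))"
    by (subst sum.swap) (intro sum.cong refl sum.swap)
  also have "\<dots> = (\<Sum>m\<in>{1..<int q}. \<Sum>l\<in>{1..<int q}. if l = m then \<chi> m * cnj (\<chi> m) * of_nat q else 0)"
  proof (intro sum.cong refl)
    fix m l assume "m \<in> {1..<int q}" "l \<in> {1..<int q}"
    then have "int q dvd m - l \<longleftrightarrow> l = m"
      using zdvd_not_zless[of "m - l" "int q"] zdvd_not_zless[of "l - m" "int q"]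
      by (cases l m rule: linorder_cases) (auto simp: dvd_diff_commute)
    then show "(\<Sum>n<q. \<chi> m * cnj (\<chi> l) * unit_exp q ((m - l) * int n)) =
        (if l = m then \<chi> m * cnj (\<chi> m) * of_nat q else 0)"
      by (simp add: sum_unit_exp[OF q0] flip: sum_distrib_left)
  qed
  also have "\<dots> = (\<Sum>m\<in>{1..<int q}. \<chi> m * cnj (\<chi> m) * of_nat q)"
    by (simp add: sum.delta)
  also have "\<dots> = of_nat (q - 1) * of_nat q"
    by (simp only: sum_norm_dchar_squared[OF assms(1,2)] flip: sum_distrib_right)
  finally have "?\<tau> * cnj ?\<tau> * of_nat (q - 1) = of_nat q * of_nat (q - 1)"
    using 1 by (simp add: mult.commute)
  then have "?\<tau> * cnj ?\<tau> = of_nat q" using q by (simp del: of_nat_diff)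
  then have "complex_of_real ((norm ?\<tau>)\<^sup>2) = complex_of_real (real q)"
    by (simp only: complex_norm_square of_real_of_nat_eq)
  then have "(norm ?\<tau>)\<^sup>2 = real q" by (simp only: of_real_eq_iff)
  then show ?thesis by (metis real_sqrt_unique norm_ge_zero)
qed

text \<open>The Gauss sum times \<open>cnj (\<chi> n)\<close> is a twisted sum. After interchanging
  summations, the inner sums over \<open>n\<close> are weighted geometric sums; their common part
  \<open>- q / 2\<close> is multiplied by the sum of \<open>\<chi>\<close>, which is zero.\<close>

lemma gauss_sum_times_first_moment:
  assumes "prime q" and "\<chi> \<in> dirichlet_characters q" and "\<chi> \<noteq> principal_character q"
  shows "gauss_sum q \<chi> * (\<Sum>n<q. of_nat n * cnj (\<chi> (int n))) = - \<i> * of_nat q ^ 2 * cot_sum q \<chi>"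
proof -
  have q: "q > 0" using assms(1) prime_gt_0_nat by blast
  have geo: "(\<Sum>n<q. of_nat n * unit_exp q (m * int n)) =
      of_nat q * (- 1 / 2) - \<i> * of_nat q ^ 2 * complex_of_real (cot_weight q m)" if m: "m \<in> {1..<int q}" for m
  proof -
    have s: "sin (pi * real_of_int m / real q) \<noteq> 0" using sin_fraction_pos[OF m] by simp
    have "unit_exp q m \<noteq> 1" using m unit_exp_eq_1_iff[OF q] zdvd_not_zless by auto
    moreover have "unit_exp q m ^ q = 1"
      unfolding unit_exp_power using unit_exp_multiple[OF q] by (simp add: mult.commute)
    ultimately have "(\<Sum>n<q. of_nat n * unit_exp q (m * int n)) = of_nat q * (1 / (unit_exp q m - 1))"
      using sum_index_times_power by (simp flip: unit_exp_power)
    also have "1 / (unit_exp q m - 1) = - 1 / 2 - \<i> / 2 * complex_of_real (cot (pi * real_of_int m / real q))"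
      using inverse_cis_minus_1[OF s] by (simp add: unit_exp_def mult.assoc)
    finally show ?thesis
      using q by (simp add: cot_weight_def field_simps power2_eq_square)
  qed
  have "gauss_sum q \<chi> * (\<Sum>n<q. of_nat n * cnj (\<chi> (int n))) =
      (\<Sum>n<q. of_nat n * (\<Sum>m\<in>{1..<int q}. \<chi> m * unit_exp q (m * int n)))"
    using twisted_gauss_sum[OF assms] by (simp add: sum_distrib_left mult_ac)
  also have "\<dots> = (\<Sum>m\<in>{1..<int q}. \<chi> m * (\<Sum>n<q. of_nat n * unit_exp q (m * int n)))"
    unfolding sum_distrib_left by (subst sum.swap) (simp add: mult_ac)
  also have "\<dots> = (\<Sum>m\<in>{1..<int q}. \<chi> m * (of_nat q * (- 1 / 2)) -
      \<i> * of_nat q ^ 2 * (\<chi> m * complex_of_real (cot_weight q m)))"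
  proof (intro sum.cong refl)
    fix m assume "m \<in> {1..<int q}"
    then show "\<chi> m * (\<Sum>n<q. of_nat n * unit_exp q (m * int n)) = \<chi> m * (of_nat q * (- 1 / 2)) -
        \<i> * of_nat q ^ 2 * (\<chi> m * complex_of_real (cot_weight q m))"
      by (simp only: geo) (simp add: algebra_simps)
  qed
  also have "\<dots> = (\<Sum>m\<in>{1..<int q}. \<chi> m) * (of_nat q * (- 1 / 2)) - \<i> * of_nat q ^ 2 * cot_sum q \<chi>"
    unfolding sum_subtractf cot_sum_def sum_distrib_left sum_distrib_right ..
  finally show ?thesis using sum_nonprincipal[OF assms(2,3)] by simp
qed

section \<open>Lower bound for the maximum of a character sum\<close>

lemma char_sum_floor: "char_sum \<chi> t = (\<Sum>n\<in>{1..nat \<lfloor>t\<rfloor>}. \<chi> (int n))"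
proof -
  have "real n \<le> t \<longleftrightarrow> n \<le> nat \<lfloor>t\<rfloor>" if "1 \<le> n" for n
    using that by (simp add: le_nat_iff le_floor_iff nat_le_iff) linarith
  then have "{n. 1 \<le> n \<and> real n \<le> t} = {1..nat \<lfloor>t\<rfloor>}" by auto
  then show ?thesis unfolding char_sum_def by simp
qed

lemma sum_over_period:
  assumes "\<chi> \<in> dirichlet_characters q" and "\<chi> \<noteq> principal_character q" and "prime q"
  shows "(\<Sum>n\<in>{1..q}. \<chi> (int n)) = 0"
proof -
  have q: "q > 1" using assms(3) prime_gt_1_nat by blast
  have "\<chi> (int q) = 0" using dchar_eq_0_iff[OF assms(1), of "int q"] q by auto
  then have "(\<Sum>n\<in>{1..q}. \<chi> (int n)) = (\<Sum>n\<in>{1..<q}. \<chi> (int n))"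
    using q by (intro sum.mono_neutral_right) auto
  also have "\<dots> = (\<Sum>m\<in>{1..<int q}. \<chi> m)"
    by (rule sum.reindex_bij_witness[of _ nat int]) auto
  finally show ?thesis using sum_nonprincipal[OF assms(1,2)] by simp
qed

text \<open>\<open>Max\<close> is an upper bound only on a finite set. Finiteness holds since a full
  period sums to zero, so that partial sums depend only on the cutoff modulo
  \<open>q\<close>.\<close>

lemma norm_partial_sum_le_max_char_sum:
  assumes "\<chi> \<in> dirichlet_characters q" and "\<chi> \<noteq> principal_character q" and "prime q"
  shows "norm (\<Sum>n\<in>{1..N}. \<chi> (int n)) \<le> max_char_sum \<chi>"
proof -
  define T where "T N = (\<Sum>n\<in>{1..N}. \<chi> (int n))" for N
  have q: "q > 0" using assms(3) prime_gt_0_nat by blast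
  have per: "T (q + n) = T n" for n
  proof (induction n)
    case 0
    then show ?case using sum_over_period[OF assms] by (simp add: T_def)
  next
    case (Suc n)
    have "\<chi> (1 + (int q + int n)) = \<chi> (1 + int n)"
      using dchar_add_modulus[OF assms(1), of "1 + int n"] by (simp add: add_ac)
    then show ?case using Suc by (simp add: T_def)
  qed
  have "T (q * k + n) = T n" for k n
    using per[of "q * _ + n"] by (induction k) (simp_all add: add.assoc)
  then have "T n = T (n mod q)" for n by (metis mult_div_mod_eq)
  then have "T n \<in> T ` {..<q}" for n using q by (metis imageI lessThan_iff mod_less_divisor)
  then have "range (\<lambda>t::real. norm (char_sum \<chi> t)) \<subseteq> norm ` T ` {..<q}"
    unfolding char_sum_floor T_def[symmetric] by auto
  then have "finite (range (\<lambda>t::real. norm (char_sum \<chi> t)))"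
    by (rule finite_subset) simp
  moreover have "norm (\<Sum>n\<in>{1..N}. \<chi> (int n)) = norm (char_sum \<chi> (real N))"
    by (simp add: char_sum_floor)
  ultimately show ?thesis unfolding max_char_sum_def by (auto intro: Max_ge)
qed

text \<open>Summation by parts: \<open>n\<close> counts the \<open>t < N\<close> with
  \<open>t < n\<close>, and the right side collects the tails beyond \<open>t\<close>.\<close>

lemma sum_index_times:
  fixes a :: "nat \<Rightarrow> 'a::comm_ring_1"
  shows "(\<Sum>n\<in>{1..N}. of_nat n * a n) = (\<Sum>t<N. (\<Sum>n\<in>{1..N}. a n) - (\<Sum>n\<in>{1..t}. a n))"
  by (induction N) (simp_all add: algebra_simps sum.distrib sum_subtractf)

lemma cot_sum_le_max_char_sum:
  assumes "prime q" and "\<chi> \<in> dirichlet_characters q" and "\<chi> \<noteq> principal_character q"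
  shows "sqrt (real q) * norm (cot_sum q \<chi>) \<le> max_char_sum \<chi>"
proof -
  have q: "q > 0" using assms(1) prime_gt_0_nat by blast
  define T where "T = (\<Sum>n<q. of_nat n * \<chi> (int n))"
  have "\<chi> (int q) = 0" using dchar_eq_0_iff[OF assms(2), of "int q"] assms(1) by auto
  \<comment> \<open>Both endpoints contribute zero: \<open>n = 0\<close> through its factor,
    \<open>n = q\<close> through \<open>\<chi> q = 0\<close>.\<close>
  then have "T = (\<Sum>n\<in>{1..q}. of_nat n * \<chi> (int n))"
    unfolding T_def by (intro sum.mono_neutral_cong) (auto simp: Suc_le_eq)
  then have "T = - (\<Sum>t<q. \<Sum>n\<in>{1..t}. \<chi> (int n))"
    unfolding sum_index_times sum_over_period[OF assms(2,3,1)] by (simp add: sum_negf)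
  then have "norm T \<le> (\<Sum>t<q. max_char_sum \<chi>)"
    using norm_partial_sum_le_max_char_sum[OF assms(2,3,1)]
    by (simp del: sum_constant) (rule sum_norm_le, simp)
  then have T: "norm T \<le> real q * max_char_sum \<chi>" by simp
  \<comment> \<open>Conjugation preserves norms, so the first moment of \<open>cnj \<chi>\<close>
    controls that of \<open>\<chi>\<close>. Taking norms, \<open>sqrt q * norm T\<close> equals
    \<open>q ^ 2\<close> times the norm of the cotangent sum, and the bound on \<open>T\<close>
    yields the claim.\<close>
  have "norm (\<Sum>n<q. of_nat n * cnj (\<chi> (int n))) = norm (cnj T)"
    by (simp add: T_def)
  then have "sqrt (real q) * norm T = real q ^ 2 * norm (cot_sum q \<chi>)"
    using arg_cong[OF gauss_sum_times_first_moment[OF assms], of norm]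
    by (simp add: norm_mult norm_power norm_gauss_sum[OF assms])
  then have "sqrt (real q) * (sqrt (real q) * norm T) = sqrt (real q) * (real q ^ 2 * norm (cot_sum q \<chi>))"
    by (rule arg_cong)
  then have "sqrt (real q) * sqrt (real q) * norm T = real q ^ 2 * (sqrt (real q) * norm (cot_sum q \<chi>))"
    by (simp only: mult_ac)
  then have "real q * norm T = real q * (real q * (sqrt (real q) * norm (cot_sum q \<chi>)))"
    by (simp add: power2_eq_square mult_ac)
  then have "norm T = real q * (sqrt (real q) * norm (cot_sum q \<chi>))"
    using q by simp
  then have "real q * (sqrt (real q) * norm (cot_sum q \<chi>)) \<le> real q * max_char_sum \<chi>"
    using T by simp
  then show ?thesis using q by simp
qed

text \<open>The reflection of \<open>m\<close> to \<open>q - m\<close> changes the sign of every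
  weight. Hence the principal character may be included in sums over characters, where full
  orthogonality is available.\<close>

lemma cot_sum_principal_character:
  assumes "prime q"
  shows "cot_sum q (principal_character q) = 0"
proof -
  have q: "q > 0" using assms prime_gt_0_nat by blast
  have "(\<Sum>m\<in>{1..<int q}. cot_weight q m) = (\<Sum>m\<in>{1..<int q}. cot_weight q (int q - m))"
    by (rule sum.reindex_bij_witness[of _ "\<lambda>m. int q - m" "\<lambda>m. int q - m"]) auto
  also have "\<dots> = - (\<Sum>m\<in>{1..<int q}. cot_weight q m)"
  proof -
    have "cot_weight q (int q - m) = - cot_weight q m" for m
    proof -
      have "pi * real_of_int (int q - m) / real q = pi - pi * real_of_int m / real q"
        using q by (simp add: field_simps)
      then show ?thesis by (simp add: cot_weight_def cot_def)
    qed
    then show ?thesis by (simp add: sum_negf)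
  qed
  finally have "(\<Sum>m\<in>{1..<int q}. cot_weight q m) = 0" by simp
  moreover have "cot_sum q (principal_character q) = (\<Sum>m\<in>{1..<int q}. complex_of_real (cot_weight q m))"
    unfolding cot_sum_def principal_character_def
    using coprime_int_prime[OF assms] by (intro sum.cong) auto
  ultimately show ?thesis by (simp only: of_real_sum[symmetric] of_real_0)
qed

section \<open>Powers of the truncated harmonic sum\<close>

text \<open>The recursion asks whether the largest admissible factor \<open>Suc N\<close> is used,
  so it runs over multisets of \<open>j\<close> factors from \<open>{1..N}\<close> rather than over
  tuples.\<close>

fun products :: "nat \<Rightarrow> nat \<Rightarrow> nat set" where
  "products N 0 = {1}"
| "products 0 (Suc j) = {}"
| "products (Suc N) (Suc j) = products N (Suc j) \<union> (*) (Suc N) ` products (Suc N) j"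

lemma finite_products [simp]: "finite (products N j)"
  by (induction N j rule: products.induct) auto

text \<open>The recursion is Pascal's, which powers of 2 satisfy. At \<open>N = j = k\<close> this
  gives \<open>4 ^ k\<close>, against \<open>k ^ k\<close> tuples of factors.\<close>

lemma card_products: "card (products N j) \<le> 2 ^ (N + j)"
proof (induction N j rule: products.induct)
  case (3 N j)
  have "card (products (Suc N) (Suc j)) \<le>
      card (products N (Suc j)) + card ((*) (Suc N) ` products (Suc N) j)"
    by (simp add: card_Un_le)
  also have "\<dots> \<le> 2 ^ (N + Suc j) + 2 ^ (Suc N + j)"
    using 3 card_image_le[of "products (Suc N) j" "(*) (Suc N)"] by (intro add_mono) auto
  finally show ?case by simp
qed auto

lemma products_bounds:
  assumes "a \<in> products N j"
  shows "1 \<le> a \<and> a \<le> N ^ j"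
  using assms
proof (induction N j arbitrary: a rule: products.induct)
  case (3 N j)
  from "3.prems" consider "a \<in> products N (Suc j)" | b where "b \<in> products (Suc N) j" "a = Suc N * b"
    by auto
  then show ?case
  proof cases
    case 1
    then have "1 \<le> a" "a \<le> N ^ Suc j" using "3.IH"(1) by auto
    moreover have "N ^ Suc j \<le> Suc N ^ Suc j" by (intro power_mono) auto
    ultimately show ?thesis by linarith
  next
    case 2
    then have "1 \<le> b" "b \<le> Suc N ^ j" using "3.IH"(2) by auto
    then have "1 \<le> Suc N * b" "Suc N * b \<le> Suc N * Suc N ^ j"
      by (simp, intro mult_le_mono) auto
    then show ?thesis using 2 by (simp only: power_Suc)
  qed
qed auto

text \<open>The recursion adjoins only the largest factor; closure under a smaller \<open>m\<close>
  needs an induction that moves \<open>m\<close> past the factors \<open>Suc N\<close>.\<close>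

lemma mult_in_products:
  assumes "m \<in> {1..N}" and "a \<in> products N j"
  shows "m * a \<in> products N (Suc j)"
  using assms
proof (induction N j arbitrary: m a rule: products.induct)
  case (1 N)
  have "m \<in> products N (Suc 0)"
    using "1.prems"(1) by (induction N) (auto simp: le_Suc_eq)
  then show ?case using "1.prems"(2) by simp
next
  case (3 N j)
  show ?case
  proof (cases "m = Suc N")
    case True
    then show ?thesis using "3.prems"(2) by (subst products.simps) blast
  next
    case False
    then have m: "m \<in> {1..N}" "m \<in> {1..Suc N}" using "3.prems"(1) by auto
    from "3.prems"(2) consider "a \<in> products N (Suc j)" | b where "b \<in> products (Suc N) j" "a = Suc N * b"
      by auto
    then show ?thesis
    proof cases
      case 1
      then show ?thesis using "3.IH"(1)[OF m(1)] by (subst products.simps) blast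
    next
      case 2
      have "Suc N * (m * b) \<in> products (Suc N) (Suc (Suc j))"
        using "3.IH"(2)[OF m(2) 2(1)] by (subst products.simps) blast
      then show ?thesis using 2(2) by (simp only: mult.left_commute)
    qed
  qed
qed auto

text \<open>\<open>coef N j n\<close> is the coefficient of \<open>\<chi> n\<close> in \<open>(\<Sum>m\<le>N. \<chi> m / m) ^ j\<close>.\<close>

fun coef :: "nat \<Rightarrow> nat \<Rightarrow> nat \<Rightarrow> real" where
  "coef N 0 n = (if n = 1 then 1 else 0)"
| "coef N (Suc j) n =
     (\<Sum>m\<in>{1..N}. \<Sum>a\<in>products N j. if m * a = n then coef N j a / real m else 0)"

lemma coef_nonneg: "coef N j n \<ge> 0"
  by (induction j arbitrary: n) (auto intro!: sum_nonneg)

text \<open>Each step multiplies by one more factor and collects the terms with equal product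
  \<open>m * a\<close>. The general \<open>h\<close> covers both the characters and the constant 1,
  which gives the total mass of the coefficients.\<close>

lemma harmonic_sum_power:
  fixes h :: "nat \<Rightarrow> 'a::real_field"
  assumes "h 1 = 1" and "\<And>m n. h (m * n) = h m * h n"
  shows "(\<Sum>m\<in>{1..N}. h m / of_nat m) ^ j = (\<Sum>n\<in>products N j. of_real (coef N j n) * h n)"
proof (induction j)
  case (Suc j)
  have "(\<Sum>n\<in>products N (Suc j). of_real (coef N (Suc j) n) * h n) =
      (\<Sum>n\<in>products N (Suc j). \<Sum>m\<in>{1..N}. \<Sum>a\<in>products N j.
        if n = m * a then of_real (coef N j a / real m) * h (m * a) else 0)"
    unfolding coef.simps of_real_sum sum_distrib_right by (intro sum.cong refl) auto
  also have "\<dots> = (\<Sum>m\<in>{1..N}. \<Sum>a\<in>products N j. \<Sum>n\<in>products N (Suc j).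
        if n = m * a then of_real (coef N j a / real m) * h (m * a) else 0)"
    by (subst sum.swap) (intro sum.cong refl sum.swap)
  also have "\<dots> = (\<Sum>m\<in>{1..N}. \<Sum>a\<in>products N j. of_real (coef N j a / real m) * h (m * a))"
    by (intro sum.cong refl) (simp add: mult_in_products sum.delta)
  also have "\<dots> = (\<Sum>m\<in>{1..N}. h m / of_nat m) * (\<Sum>a\<in>products N j. of_real (coef N j a) * h a)"
    by (simp add: sum_product assms(2) mult_ac)
  finally show ?case using Suc by simp
qed (use assms(1) in simp)

section \<open>Estimates for the sum of squared coefficients\<close>

lemma ln_le_harmonic_sum: "ln (real N + 1) \<le> (\<Sum>m\<in>{1..N}. 1 / real m)"
proof (induction N)
  case (Suc N)
  have "ln (real (Suc N) + 1) = ln ((real N + 1) * (1 + 1 / (real N + 1)))"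
    by (rule arg_cong[of _ _ ln]) (simp add: field_simps)
  also have "\<dots> = ln (real N + 1) + ln (1 + 1 / (real N + 1))"
    by (rule ln_mult_pos) (auto intro: add_pos_pos)
  also have "ln (1 + 1 / (real N + 1)) \<le> 1 / (real N + 1)"
    by (rule ln_add_one_self_le_self) simp
  finally show ?case using Suc by (simp add: add.commute)
qed simp

lemma sum_coef_squared_ge:
  assumes "k \<ge> 1"
  shows "ln (real k) ^ (2 * k) \<le> 4 ^ k * (\<Sum>n\<in>products k k. (coef k k n)\<^sup>2)"
proof -
  let ?H = "\<Sum>m\<in>{1..k}. 1 / real m"
  have "ln (real k) \<le> ln (real k + 1)" using assms by simp
  then have "ln (real k) \<le> ?H" using ln_le_harmonic_sum[of k] by linarith
  then have "ln (real k) ^ (2 * k) \<le> ?H ^ (2 * k)"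
    using assms by (intro power_mono) auto
  also have "\<dots> = (?H ^ k)\<^sup>2" by (simp add: power_mult mult.commute)
  also have "?H ^ k = (\<Sum>n\<in>products k k. coef k k n)"
    using harmonic_sum_power[of "\<lambda>_. 1::real" k k] by simp
  \<comment> \<open>Cauchy--Schwarz costs only the number of distinct products.\<close>
  also have "\<dots>\<^sup>2 \<le> (\<Sum>n\<in>products k k. (coef k k n)\<^sup>2) * card (products k k)"
    by (rule sum_squared_le_sum_of_squares)
  also have "\<dots> \<le> (\<Sum>n\<in>products k k. (coef k k n)\<^sup>2) * 4 ^ k"
  proof (rule mult_left_mono)
    have "real (card (products k k)) \<le> real (2 ^ (k + k))"
      using card_products[of k k] by (simp only: of_nat_le_iff)
    also have "real (2 ^ (k + k)) = 4 ^ k"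
      by (simp add: power_add flip: power_mult_distrib)
    finally show "real (card (products k k)) \<le> 4 ^ k" .
  qed (simp add: sum_nonneg)
  finally show ?thesis by (simp add: mult.commute)
qed

text \<open>One copy of the coefficient is unfolded along a factor \<open>m = n / a\<close>, with
  \<open>1 / m = a / n\<close>. Dropping the condition \<open>m \<le> N\<close> only increases the
  sum, as coefficients are nonnegative. The result is \<open>2 * pi\<close> times the limit of the
  correlation, where \<open>m\<close> is not bounded by \<open>N\<close>.\<close>

lemma sum_coef_squared_le:
  "(\<Sum>n\<in>products N (Suc j). (coef N (Suc j) n)\<^sup>2) \<le>
   (\<Sum>n\<in>products N (Suc j). \<Sum>a\<in>products N j.
      coef N (Suc j) n * coef N j a * (if a dvd n then real a / real n else 0))"
proof (rule sum_mono)
  fix n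
  have inner: "(\<Sum>m\<in>{1..N}. if m * a = n then coef N j a / real m else 0) \<le>
      coef N j a * (if a dvd n then real a / real n else 0)" if "a \<in> products N j" for a
  proof -
    have a: "a \<ge> 1" using products_bounds[OF that] by simp
    have "(\<Sum>m\<in>{1..N}. if m * a = n then coef N j a / real m else 0) =
        (\<Sum>m\<in>{1..N}. if m = n div a then (if a dvd n then coef N j a * (real a / real n) else 0) else 0)"
      using a by (intro sum.cong refl) (auto simp: field_simps)
    also have "\<dots> \<le> coef N j a * (if a dvd n then real a / real n else 0)"
      using coef_nonneg[of N j a] by (simp add: sum.delta)
    finally show ?thesis .
  qed
  have "coef N (Suc j) n = (\<Sum>a\<in>products N j. \<Sum>m\<in>{1..N}. if m * a = n then coef N j a / real m else 0)"
    unfolding coef.simps by (rule sum.swap)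
  also have "\<dots> \<le> (\<Sum>a\<in>products N j. coef N j a * (if a dvd n then real a / real n else 0))"
    by (rule sum_mono[OF inner])
  finally have "coef N (Suc j) n * coef N (Suc j) n \<le> coef N (Suc j) n * \<dots>"
    by (rule mult_left_mono) (rule coef_nonneg)
  then show "(coef N (Suc j) n)\<^sup>2 \<le> (\<Sum>a\<in>products N j.
      coef N (Suc j) n * coef N j a * (if a dvd n then real a / real n else 0))"
    by (simp only: power2_eq_square sum_distrib_left mult.assoc)
qed

section \<open>Mean values over characters\<close>

text \<open>Orthogonality applied to every pair of terms. The congruence stays in the result because
  in the correlation one argument runs through all residues and need not equal the other.\<close>

lemma dchar_mean_value:
  assumes "prime q" and "\<And>i. i \<in> I \<Longrightarrow> coprime (u i) (int q)" and "\<And>j. j \<in> J \<Longrightarrow> coprime (v j) (int q)"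
  shows "(\<Sum>\<chi>\<in>dirichlet_characters q. (\<Sum>i\<in>I. f i * \<chi> (u i)) * cnj (\<Sum>j\<in>J. g j * \<chi> (v j))) =
    of_nat (q - 1) * (\<Sum>i\<in>I. \<Sum>j\<in>J. if [u i = v j] (mod int q) then f i * cnj (g j) else 0)"
proof -
  have "(\<Sum>\<chi>\<in>dirichlet_characters q. (\<Sum>i\<in>I. f i * \<chi> (u i)) * cnj (\<Sum>j\<in>J. g j * \<chi> (v j))) =
    (\<Sum>\<chi>\<in>dirichlet_characters q. \<Sum>i\<in>I. \<Sum>j\<in>J. f i * cnj (g j) * (\<chi> (u i) * cnj (\<chi> (v j))))"
    unfolding cnj_sum sum_product by (simp add: mult_ac)
  also have "\<dots> = (\<Sum>i\<in>I. \<Sum>j\<in>J. \<Sum>\<chi>\<in>dirichlet_characters q. f i * cnj (g j) * (\<chi> (u i) * cnj (\<chi> (v j))))"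
    by (subst sum.swap) (intro sum.cong refl sum.swap)
  also have "\<dots> = (\<Sum>i\<in>I. \<Sum>j\<in>J. of_nat (q - 1) * (if [u i = v j] (mod int q) then f i * cnj (g j) else 0))"
    by (intro sum.cong refl) (simp add: dchar_orthogonality[OF assms(1,2,3)] flip: sum_distrib_left)
  finally show ?thesis by (simp only: sum_distrib_left)
qed

definition harmonic_char_sum :: "nat \<Rightarrow> (int \<Rightarrow> complex) \<Rightarrow> complex" where
  "harmonic_char_sum N \<chi> = (\<Sum>m\<in>{1..N}. \<chi> (int m) / of_nat m)"

lemma harmonic_char_sum_power:
  assumes "\<chi> \<in> dirichlet_characters q"
  shows "harmonic_char_sum N \<chi> ^ j = (\<Sum>n\<in>products N j. complex_of_real (coef N j n) * \<chi> (int n))"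
  unfolding harmonic_char_sum_def
  by (rule harmonic_sum_power) (simp_all add: dchar_1[OF assms] dchar_mult[OF assms])

lemma coprime_products:
  assumes "prime q" and "N ^ j < q" and "a \<in> products N j"
  shows "coprime (int a) (int q)"
  by (rule coprime_int_prime[OF assms(1)]) (use products_bounds[OF assms(3)] assms(2) in auto)

text \<open>All products are at most \<open>N ^ j < q\<close>, where congruence means equality, so
  only the diagonal survives.\<close>

lemma harmonic_char_sum_moment:
  assumes "prime q" and "N ^ j < q"
  shows "(\<Sum>\<chi>\<in>dirichlet_characters q. norm (harmonic_char_sum N \<chi>) ^ (2 * j)) =
    real (q - 1) * (\<Sum>n\<in>products N j. (coef N j n)\<^sup>2)"
proof -
  have "complex_of_real (\<Sum>\<chi>\<in>dirichlet_characters q. norm (harmonic_char_sum N \<chi>) ^ (2 * j)) =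
    (\<Sum>\<chi>\<in>dirichlet_characters q. harmonic_char_sum N \<chi> ^ j * cnj (harmonic_char_sum N \<chi> ^ j))"
    unfolding of_real_sum
  proof (intro sum.cong refl)
    fix \<chi>
    have "norm (harmonic_char_sum N \<chi>) ^ (2 * j) = (norm (harmonic_char_sum N \<chi> ^ j))\<^sup>2"
      by (simp add: norm_power power_mult mult.commute)
    then show "complex_of_real (norm (harmonic_char_sum N \<chi>) ^ (2 * j)) =
        harmonic_char_sum N \<chi> ^ j * cnj (harmonic_char_sum N \<chi> ^ j)"
      by (simp only: complex_norm_square)
  qed
  also have "\<dots> = (\<Sum>\<chi>\<in>dirichlet_characters q. (\<Sum>n\<in>products N j. complex_of_real (coef N j n) * \<chi> (int n)) *
      cnj (\<Sum>n\<in>products N j. complex_of_real (coef N j n) * \<chi> (int n)))"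
    by (intro sum.cong refl) (simp only: harmonic_char_sum_power)
  also have "\<dots> = of_nat (q - 1) * (\<Sum>a\<in>products N j. \<Sum>n\<in>products N j.
      if [int a = int n] (mod int q) then complex_of_real (coef N j a) * cnj (complex_of_real (coef N j n)) else 0)"
    by (rule dchar_mean_value[OF assms(1)]) (rule coprime_products[OF assms], assumption)+
  also have "\<dots> = of_nat (q - 1) * (\<Sum>a\<in>products N j. \<Sum>n\<in>products N j.
      if n = a then complex_of_real ((coef N j a)\<^sup>2) else 0)"
  proof -
    have "[int a = int n] (mod int q) \<longleftrightarrow> n = a" if "a \<in> products N j" "n \<in> products N j" for a n
    proof -
      have "a < q" "n < q"
        using products_bounds[OF that(1)] products_bounds[OF that(2)] assms(2) by linarith+
      then show ?thesis by (auto simp: cong_int_iff dest: cong_less_modulus_unique_nat)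
    qed
    then show ?thesis
      by (intro arg_cong2[of _ _ _ _ "(*)"] refl sum.cong) (simp_all add: power2_eq_square)
  qed
  also have "\<dots> = complex_of_real (real (q - 1) * (\<Sum>n\<in>products N j. (coef N j n)\<^sup>2))"
    by (simp add: sum.delta)
  finally show ?thesis by (simp only: of_real_eq_iff)
qed

text \<open>For prime \<open>q\<close> and \<open>a\<close>, \<open>n\<close> prime to
  \<open>q\<close>, orthogonality makes this the mean of
  \<open>cot_sum q \<chi> * \<chi> a * cnj (\<chi> n)\<close> over the characters; at most one
  \<open>m\<close> contributes.\<close>

definition congruent_weight :: "nat \<Rightarrow> nat \<Rightarrow> nat \<Rightarrow> real" where
  "congruent_weight q n a =
     (\<Sum>m\<in>{1..<int q}. if [m * int a = int n] (mod int q) then cot_weight q m else 0)"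

lemma cot_sum_correlation:
  assumes "prime q" and "N ^ i < q" and "N ^ j < q"
  shows "(\<Sum>\<chi>\<in>dirichlet_characters q.
      cot_sum q \<chi> * harmonic_char_sum N \<chi> ^ j * cnj (harmonic_char_sum N \<chi> ^ i)) =
    complex_of_real (real (q - 1) * (\<Sum>n\<in>products N i. \<Sum>a\<in>products N j.
      coef N i n * coef N j a * congruent_weight q n a))"
proof -
  \<comment> \<open>The product becomes a single sum over pairs \<open>(m, a)\<close> with character
    argument \<open>m * a\<close>, as the mean value formula expects.\<close>
  have L: "cot_sum q \<chi> * harmonic_char_sum N \<chi> ^ j =
      (\<Sum>x\<in>{1..<int q} \<times> products N j. complex_of_real (cot_weight q (fst x) * coef N j (snd x)) *
        \<chi> (fst x * int (snd x)))" if "\<chi> \<in> dirichlet_characters q" for \<chi>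
    unfolding harmonic_char_sum_power[OF that] cot_sum_def sum_product sum.cartesian_product
    by (simp add: case_prod_unfold dchar_mult[OF that] mult_ac)
  have "(\<Sum>\<chi>\<in>dirichlet_characters q.
      cot_sum q \<chi> * harmonic_char_sum N \<chi> ^ j * cnj (harmonic_char_sum N \<chi> ^ i)) =
    (\<Sum>\<chi>\<in>dirichlet_characters q.
      (\<Sum>x\<in>{1..<int q} \<times> products N j. complex_of_real (cot_weight q (fst x) * coef N j (snd x)) *
        \<chi> (fst x * int (snd x))) *
      cnj (\<Sum>n\<in>products N i. complex_of_real (coef N i n) * \<chi> (int n)))"
    by (intro sum.cong refl arg_cong2[of _ _ _ _ "(*)"] L) (simp_all only: harmonic_char_sum_power)
  also have "\<dots> = of_nat (q - 1) * (\<Sum>x\<in>{1..<int q} \<times> products N j. \<Sum>n\<in>products N i.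
      if [fst x * int (snd x) = int n] (mod int q)
      then complex_of_real (cot_weight q (fst x) * coef N j (snd x)) * cnj (complex_of_real (coef N i n)) else 0)"
  proof (rule dchar_mean_value[OF assms(1)])
    fix x assume "x \<in> {1..<int q} \<times> products N j"
    then show "coprime (fst x * int (snd x)) (int q)"
      using coprime_int_prime[OF assms(1)] coprime_products[OF assms(1,3)] by auto
  qed (rule coprime_products[OF assms(1,2)])
  also have "\<dots> = complex_of_real (real (q - 1) * (\<Sum>x\<in>{1..<int q} \<times> products N j. \<Sum>n\<in>products N i.
      if [fst x * int (snd x) = int n] (mod int q)
      then cot_weight q (fst x) * coef N j (snd x) * coef N i n else 0))"
    unfolding of_real_mult of_real_sum
    by (intro arg_cong2[of _ _ _ _ "(*)"] sum.cong refl) auto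
  also have "(\<Sum>x\<in>{1..<int q} \<times> products N j. \<Sum>n\<in>products N i.
      if [fst x * int (snd x) = int n] (mod int q)
      then cot_weight q (fst x) * coef N j (snd x) * coef N i n else 0) =
    (\<Sum>n\<in>products N i. \<Sum>x\<in>{1..<int q} \<times> products N j.
      if [fst x * int (snd x) = int n] (mod int q)
      then cot_weight q (fst x) * coef N j (snd x) * coef N i n else 0)"
    by (rule sum.swap)
  also have "\<dots> = (\<Sum>n\<in>products N i. \<Sum>a\<in>products N j. \<Sum>m\<in>{1..<int q}.
      if [m * int a = int n] (mod int q) then cot_weight q m * coef N j a * coef N i n else 0)"
  proof -
    have swap: "(\<Sum>a\<in>B. \<Sum>m\<in>{1..<int q}. F m a) = (\<Sum>x\<in>{1..<int q} \<times> B. F (fst x) (snd x))"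
      for B and F :: "int \<Rightarrow> nat \<Rightarrow> real"
      by (subst sum.swap) (simp add: sum.cartesian_product case_prod_unfold)
    show ?thesis by (simp only: swap)
  qed
  also have "\<dots> = (\<Sum>n\<in>products N i. \<Sum>a\<in>products N j. coef N i n * coef N j a * congruent_weight q n a)"
    unfolding congruent_weight_def sum_distrib_left
    by (intro sum.cong refl) auto
  finally show ?thesis .
qed

section \<open>Limits as the modulus grows\<close>

lemma cot_weight_tendsto:
  assumes "m > 0"
  shows "(\<lambda>q. cot_weight q (int m)) \<longlonglongrightarrow> 1 / (2 * pi * real m)"
proof -
  have "1 / (2 * pi * real m) = inverse pi * inverse (real m) / 2"
    by (simp add: field_simps)
  moreover have "(\<lambda>q. cos (pi * real m / real q) / sin (pi * real m / real q) / (2 * real q))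
      \<longlonglongrightarrow> inverse pi * inverse (real m) / 2"
    using assms by real_asymp
  ultimately show ?thesis by (simp only: cot_weight_def cot_def of_int_of_nat_eq)
qed

text \<open>On the interval from \<open>d\<close> to \<open>pi - d\<close> the sine is smallest at
  the endpoints.\<close>

lemma abs_cot_le:
  assumes "0 < d" and "d \<le> t" and "t \<le> pi - d"
  shows "\<bar>cot t\<bar> \<le> 1 / sin d"
proof -
  have d: "d \<le> pi / 2" using assms by linarith
  have "sin d > 0" using assms d by (intro sin_gt_zero) auto
  moreover have "sin d \<le> sin t"
  proof (cases "t \<le> pi / 2")
    case True
    then show ?thesis using assms by (intro sin_monotone_2pi_le) auto
  next
    case False
    then have "sin d \<le> sin (pi - t)" using assms d by (intro sin_monotone_2pi_le) auto
    then show ?thesis by simp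
  qed
  ultimately show ?thesis unfolding cot_def abs_divide by (intro frac_le) auto
qed

lemma cong_mult_unique:
  assumes "prime q" and "0 < a" and "a < q" and "m \<in> {0..<int q}" and "l \<in> {0..<int q}"
    and "[m * int a = l * int a] (mod int q)"
  shows "m = l"
proof -
  have "coprime (int a) (int q)"
    by (rule coprime_int_prime[OF assms(1)]) (use assms(2,3) in auto)
  then have "[m = l] (mod int q)" using assms(6) by (simp add: cong_mult_rcancel)
  then show ?thesis using assms(4,5) by (intro cong_less_imp_eq_int) auto
qed

text \<open>For prime \<open>q > n\<close> the only contributing \<open>m\<close> is the fixed
  integer \<open>n / a\<close>, so the limit is that of a single weight.\<close>

lemma congruent_weight_tendsto_dvd:
  assumes "a dvd n" and "n > 0"
  shows "((\<lambda>q. congruent_weight q n a) \<longlongrightarrow> real a / (2 * pi * real n))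
    (inf sequentially (principal {q. prime q}))"
proof -
  obtain l where l: "n = a * l" using assms(1) by blast
  have pos: "a > 0" "l > 0" using assms(2) l by auto
  have le: "a \<le> n" "l \<le> n" using l pos by auto
  have "congruent_weight q n a = cot_weight q (int l)" if q: "prime q" "q > n" for q
  proof -
    have "[m * int a = int n] (mod int q) \<longleftrightarrow> m = int l" if m: "m \<in> {1..<int q}" for m
      using cong_mult_unique[OF q(1) pos(1), of m "int l"] m le q(2) l by (auto simp: mult.commute)
    then have "congruent_weight q n a = (\<Sum>m\<in>{1..<int q}. if m = int l then cot_weight q m else 0)"
      unfolding congruent_weight_def by (intro sum.cong) auto
    also have "\<dots> = cot_weight q (int l)" using pos le q(2) by simp
    finally show ?thesis .
  qed
  then have "eventually (\<lambda>q. q \<in> {q. prime q} \<longrightarrow> congruent_weight q n a = cot_weight q (int l)) sequentially"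
    by (intro eventually_mono[OF eventually_gt_at_top[of n]]) simp
  then have "eventually (\<lambda>q. congruent_weight q n a = cot_weight q (int l)) (inf sequentially (principal {q. prime q}))"
    by (simp only: eventually_inf_principal)
  moreover have "((\<lambda>q. cot_weight q (int l)) \<longlongrightarrow> 1 / (2 * pi * real l))
      (inf sequentially (principal {q. prime q}))"
    by (rule tendsto_mono[OF inf_le1 cot_weight_tendsto[OF pos(2)]])
  moreover have "1 / (2 * pi * real l) = real a / (2 * pi * real n)"
    using l pos by simp
  ultimately show ?thesis by (simp only: tendsto_cong)
qed

text \<open>If \<open>m a \<equiv> n\<close> modulo \<open>q\<close> but \<open>m a \<noteq> n\<close>, then \<open>m / q\<close> stays away from \<open>0\<close> and \<open>1\<close>,
  so the cotangent is bounded.\<close>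

lemma congruent_weight_tendsto_not_dvd:
  assumes "\<not> a dvd n" and "a > 0"
  shows "((\<lambda>q. congruent_weight q n a) \<longlongrightarrow> 0) (inf sequentially (principal {q. prime q}))"
proof -
  \<comment> \<open>A contributing \<open>m\<close> satisfies
    \<open>q \<le> m * a \<le> n + q * (a - 1)\<close>. With \<open>2 * n \<le> q\<close>, both
    \<open>m / q\<close> and \<open>1 - m / q\<close> are at least
    \<open>1 / (2 * a)\<close>.\<close>
  define d where "d = pi / (2 * real a)"
  define C where "C = 1 / sin d"
  have a: "real a \<ge> 1" using assms(2) by simp
  have d0: "0 < d" using assms(2) by (simp add: d_def)
  have "d \<le> pi / 2" using a by (simp add: d_def field_simps)
  then have C0: "C > 0" unfolding C_def using d0 by (auto intro!: sin_gt_zero)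
  \<comment> \<open>Here \<open>q > a\<close> gives at most one solution \<open>m\<close>, while
    \<open>q > 2 * n\<close> excludes a negative \<open>j\<close> and provides the upper
    margin.\<close>
  have bound: "\<bar>congruent_weight q n a\<bar> \<le> C / (2 * real q)" if q: "prime q" "q > a + 2 * n" for q
  proof -
    define S where "S = {m \<in> {1..<int q}. [m * int a = int n] (mod int q)}"
    have fin: "finite S" unfolding S_def by (rule finite_subset[of _ "{1..<int q}"]) auto
    have q0: "real q > 0" using q(2) by simp
    have "m = l" if "m \<in> S" "l \<in> S" for m l
    proof (rule cong_mult_unique[OF q(1) assms(2)])
      show "[m * int a = l * int a] (mod int q)"
        using that unfolding S_def by (metis (mono_tags, lifting) cong_sym cong_trans mem_Collect_eq)
    qed (use that q(2) in \<open>auto simp: S_def\<close>)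
    then have card: "card S \<le> 1" using fin by (auto simp: card_le_Suc0_iff_eq)
    have w: "\<bar>cot_weight q m\<bar> \<le> C / (2 * real q)" if "m \<in> S" for m
    proof -
      have m: "1 \<le> m" "m < int q" "[int n = m * int a] (mod int q)"
        using that cong_sym by (auto simp: S_def)
      then obtain j where j: "m * int a = int n + int q * j"
        using cong_iff_lin by blast
      \<comment> \<open>This is where \<open>\<not> a dvd n\<close> enters: \<open>j = 0\<close>
        would mean \<open>m * a = n\<close>.\<close>
      have "j \<noteq> 0"
      proof
        assume "j = 0"
        then have "int a dvd int n" using j by (metis add_0_right dvd_triv_right mult_zero_right)
        then show False using assms(1) by simp
      qed
      moreover have "j \<ge> 0"
      proof (rule ccontr)
        assume "\<not> j \<ge> 0"
        then have "int q * j \<le> int q * (- 1)" by (intro mult_left_mono) auto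
        moreover have "0 < m * int a" using m assms(2) by simp
        ultimately show False using j q(2) by linarith
      qed
      moreover have "j < int a"
      proof -
        have "int q * j \<le> m * int a" using j by simp
        also have "\<dots> < int q * int a" using m assms(2) by simp
        finally show ?thesis by (simp add: mult_less_cancel_left)
      qed
      ultimately have "1 \<le> j" "j \<le> int a - 1" by linarith+
      then have "int q * 1 \<le> int q * j" "int q * j \<le> int q * (int a - 1)"
        by (intro mult_left_mono; simp)+
      then have "int q \<le> m * int a" "m * int a \<le> int n + int q * int a - int q"
        using j by (auto simp: right_diff_distrib)
      then have "real_of_int (int q) \<le> real_of_int (m * int a)"
        "real_of_int (m * int a) \<le> real_of_int (int n + int q * int a - int q)"
        by (simp_all only: of_int_le_iff)
      then have lo: "real q \<le> real_of_int m * real a"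
        and hi: "real_of_int m * real a \<le> real n + real q * real a - real q"
        by simp_all
      have n: "2 * real n \<le> real q" using q(2) by simp
      have "d \<le> pi * real_of_int m / real q"
      proof -
        have "1 / (2 * real a) \<le> real_of_int m / real q"
          using lo a q0 by (simp add: field_simps)
        then have "pi * (1 / (2 * real a)) \<le> pi * (real_of_int m / real q)"
          by (intro mult_left_mono) auto
        then show ?thesis by (simp add: d_def)
      qed
      moreover have "pi * real_of_int m / real q \<le> pi - d"
      proof -
        have "real_of_int m / real q \<le> 1 - 1 / (2 * real a)"
          using hi n a q0 by (simp add: field_simps)
        then have "pi * (real_of_int m / real q) \<le> pi * (1 - 1 / (2 * real a))"
          by (intro mult_left_mono) auto
        then show ?thesis by (simp add: d_def right_diff_distrib)
      qed
      ultimately have "\<bar>cot (pi * real_of_int m / real q)\<bar> \<le> C"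
        unfolding C_def by (rule abs_cot_le[OF d0])
      then show ?thesis using q0 by (simp add: cot_weight_def abs_divide divide_right_mono)
    qed
    have "congruent_weight q n a = (\<Sum>m\<in>S. cot_weight q m)"
      unfolding congruent_weight_def S_def by (rule sum.inter_filter[symmetric]) simp
    also have "\<bar>\<dots>\<bar> \<le> (\<Sum>m\<in>S. \<bar>cot_weight q m\<bar>)" by (rule sum_abs)
    also have "\<dots> \<le> real (card S) * (C / (2 * real q))"
      using w by (rule sum_bounded_above)
    also have "\<dots> \<le> 1 * (C / (2 * real q))"
      using card C0 by (intro mult_right_mono) auto
    finally show ?thesis by simp
  qed
  have "(\<lambda>q. C / (2 * real q)) \<longlonglongrightarrow> 0" by real_asymp
  then have "((\<lambda>q. C / (2 * real q)) \<longlongrightarrow> 0) (inf sequentially (principal {q. prime q}))"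
    by (rule tendsto_mono[OF inf_le1])
  moreover have "eventually (\<lambda>q. norm (congruent_weight q n a) \<le> norm (C / (2 * real q)) * 1)
      (inf sequentially (principal {q. prime q}))"
    unfolding eventually_inf_principal using eventually_gt_at_top[of "a + 2 * n"]
    by (rule eventually_mono) (use bound C0 in simp)
  ultimately show ?thesis by (rule tendsto_0_le)
qed

lemma congruent_weight_tendsto:
  assumes "a > 0" and "n > 0"
  shows "((\<lambda>q. congruent_weight q n a) \<longlongrightarrow> (if a dvd n then real a / real n else 0) / (2 * pi))
    (inf sequentially (principal {q. prime q}))"
  using congruent_weight_tendsto_dvd[of a n] congruent_weight_tendsto_not_dvd[of a n] assms
  by (cases "a dvd n") (simp_all add: mult_ac)

section \<open>The moment bound\<close>

text \<open>By convexity, the graph of the power lies above its tangent at \<open>y\<close>.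
  Division by \<open>y ^ Suc p\<close> reduces this to Bernoulli's inequality at
  \<open>x / y - 1\<close>, whence the separate case \<open>y = 0\<close>.\<close>

lemma power_ge_tangent:
  fixes x y :: real
  assumes "x \<ge> 0" and "y \<ge> 0"
  shows "real (Suc p) * (x * y ^ p) - real p * y ^ Suc p \<le> x ^ Suc p"
proof (cases "y = 0")
  case True
  then show ?thesis using assms by (cases p) auto
next
  case False
  then have y: "y > 0" using assms by simp
  have "1 + real (Suc p) * (x / y - 1) \<le> (1 + (x / y - 1)) ^ Suc p"
    using assms y by (intro Bernoulli_inequality) simp
  then have "(1 + real (Suc p) * (x / y - 1)) * y ^ Suc p \<le> (x / y) ^ Suc p * y ^ Suc p"
    using y by (intro mult_right_mono) auto
  also have "\<dots> = x ^ Suc p" using y by (simp only: power_divide) simp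
  also have "(1 + real (Suc p) * (x / y - 1)) * y ^ Suc p = real (Suc p) * (x * y ^ p) - real p * y ^ Suc p"
    using y by (simp add: field_simps)
  finally show ?thesis .
qed

text \<open>Summing the tangent inequality for \<open>x = 4 \<pi> \<bar>L\<bar>\<close>, \<open>y = \<bar>A\<bar>\<close> over all characters, where
  \<open>L\<close> is the cotangent sum and \<open>A\<close> the truncated harmonic sum, plays the role of Hoelder's inequality.\<close>

lemma cot_sum_moment_ge:
  assumes "prime q" and "N ^ Suc j < q"
    and "D / (4 * pi) \<le> (\<Sum>n\<in>products N (Suc j). \<Sum>a\<in>products N j.
      coef N (Suc j) n * coef N j a * congruent_weight q n a)"
    and "D = (\<Sum>n\<in>products N (Suc j). (coef N (Suc j) n)\<^sup>2)"
    and "N > 0"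
  shows "real (q - 1) * D \<le>
    (\<Sum>\<chi>\<in>dirichlet_characters q. (4 * pi * norm (cot_sum q \<chi>)) ^ (2 * Suc j))"
proof -
  let ?D = "dirichlet_characters q"
  define A where "A = harmonic_char_sum N"
  define L where "L = cot_sum q"
  define R where "R = (\<Sum>n\<in>products N (Suc j). \<Sum>a\<in>products N j.
      coef N (Suc j) n * coef N j a * congruent_weight q n a)"
  have "N ^ j \<le> N ^ Suc j" using assms(5) by (intro power_increasing) auto
  then have j: "N ^ j < q" using assms(2) by linarith
  have "real (q - 1) * (D / (4 * pi)) \<le> real (q - 1) * R"
    using assms(3) unfolding R_def by (rule mult_left_mono) simp
  also have "\<dots> \<le> norm (complex_of_real (real (q - 1) * R))"
    unfolding norm_of_real by (rule abs_ge_self)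
  also have "complex_of_real (real (q - 1) * R) = (\<Sum>\<chi>\<in>?D. L \<chi> * A \<chi> ^ j * cnj (A \<chi> ^ Suc j))"
    unfolding L_def A_def R_def by (rule cot_sum_correlation[OF assms(1,2) j, symmetric])
  also have "norm \<dots> \<le> (\<Sum>\<chi>\<in>?D. norm (L \<chi>) * norm (A \<chi>) ^ Suc (2 * j))"
  proof (rule order_trans[OF norm_sum])
    have "norm z ^ Suc (2 * j) = norm z ^ j * norm z ^ Suc j" for z :: complex
      by (simp add: mult_2 power_add)
    then show "(\<Sum>\<chi>\<in>?D. norm (L \<chi> * A \<chi> ^ j * cnj (A \<chi> ^ Suc j))) \<le>
        (\<Sum>\<chi>\<in>?D. norm (L \<chi>) * norm (A \<chi>) ^ Suc (2 * j))"
      by (simp only: norm_mult norm_power complex_mod_cnj mult.assoc order_refl)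
  qed
  finally have corr: "real (q - 1) * (D / (4 * pi)) \<le> (\<Sum>\<chi>\<in>?D. norm (L \<chi>) * norm (A \<chi>) ^ Suc (2 * j))" .
  have mom: "(\<Sum>\<chi>\<in>?D. norm (A \<chi>) ^ (2 * Suc j)) = real (q - 1) * D"
    unfolding A_def assms(4) by (rule harmonic_char_sum_moment[OF assms(1,2)])
  \<comment> \<open>The coefficients balance: \<open>4 * pi\<close> cancels the denominator and
    \<open>2 * (j + 1) - (2 * j + 1) = 1\<close>, so the bounds for the correlation and the moment
    leave exactly \<open>(q - 1) * D\<close>.\<close>
  have "real (q - 1) * D = real (2 * Suc j) * (4 * pi) * (real (q - 1) * (D / (4 * pi))) -
      real (Suc (2 * j)) * (real (q - 1) * D)"
    by (simp add: field_simps)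
  also have "\<dots> \<le> real (2 * Suc j) * (4 * pi) * (\<Sum>\<chi>\<in>?D. norm (L \<chi>) * norm (A \<chi>) ^ Suc (2 * j)) -
      real (Suc (2 * j)) * (\<Sum>\<chi>\<in>?D. norm (A \<chi>) ^ (2 * Suc j))"
    unfolding mom by (intro diff_right_mono mult_left_mono corr) simp
  also have "\<dots> = (\<Sum>\<chi>\<in>?D. real (2 * Suc j) * (4 * pi * norm (L \<chi>) * norm (A \<chi>) ^ Suc (2 * j)) -
      real (Suc (2 * j)) * norm (A \<chi>) ^ (2 * Suc j))"
    unfolding sum_subtractf sum_distrib_left by (simp only: mult.assoc)
  also have "\<dots> \<le> (\<Sum>\<chi>\<in>?D. (4 * pi * norm (L \<chi>)) ^ (2 * Suc j))"
  proof (rule sum_mono)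
    fix \<chi>
    show "real (2 * Suc j) * (4 * pi * norm (L \<chi>) * norm (A \<chi>) ^ Suc (2 * j)) -
        real (Suc (2 * j)) * norm (A \<chi>) ^ (2 * Suc j) \<le> (4 * pi * norm (L \<chi>)) ^ (2 * Suc j)"
      using power_ge_tangent[of "4 * pi * norm (L \<chi>)" "norm (A \<chi>)" "Suc (2 * j)"] by simp
  qed
  finally show ?thesis unfolding L_def .
qed

text \<open>The principal term is zero because \<open>k > 0\<close>; for the others,
  \<open>q ^ k\<close> is the \<open>2 * k\<close>-th power of \<open>sqrt q\<close>.\<close>

lemma sum_cot_sum_le_sum_max_char_sum:
  assumes "prime q" and "k > 0"
  shows "real q ^ k * (\<Sum>\<chi>\<in>dirichlet_characters q. norm (cot_sum q \<chi>) ^ (2 * k)) \<le>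
    (\<Sum>\<chi>\<in>dirichlet_characters q - {principal_character q}. max_char_sum \<chi> ^ (2 * k))"
proof -
  have "real q ^ k * (\<Sum>\<chi>\<in>dirichlet_characters q. norm (cot_sum q \<chi>) ^ (2 * k)) =
      real q ^ k * (\<Sum>\<chi>\<in>dirichlet_characters q - {principal_character q}. norm (cot_sum q \<chi>) ^ (2 * k))"
    using finite_dirichlet_characters[OF assms(1)] cot_sum_principal_character[OF assms(1)] assms(2)
    by (subst sum.remove[OF _ principal_character_in_dirichlet_characters]) auto
  also have "\<dots> = (\<Sum>\<chi>\<in>dirichlet_characters q - {principal_character q}.
      (sqrt (real q) * norm (cot_sum q \<chi>)) ^ (2 * k))"
    unfolding sum_distrib_left power_mult_distrib power_mult[of _ 2] by simp
  also have "\<dots> \<le> (\<Sum>\<chi>\<in>dirichlet_characters q - {principal_character q}. max_char_sum \<chi> ^ (2 * k))"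
    using cot_sum_le_max_char_sum[OF assms(1)] by (intro sum_mono power_mono) auto
  finally show ?thesis .
qed

lemma eventually_sum_max_char_sum_ge:
  assumes "k \<ge> 2"
  shows "eventually (\<lambda>q. real (q - 1) * real q ^ k * (ln (real k) / (8 * pi)) ^ (2 * k) \<le>
      (\<Sum>\<chi>\<in>dirichlet_characters q - {principal_character q}. max_char_sum \<chi> ^ (2 * k)))
    (inf sequentially (principal {q. prime q}))"
proof -
  obtain j where j: "k = Suc j" using assms by (cases k) auto
  define D where "D = (\<Sum>n\<in>products k k. (coef k k n)\<^sup>2)"
  define R where "R q = (\<Sum>n\<in>products k k. \<Sum>a\<in>products k j.
      coef k k n * coef k j a * congruent_weight q n a)" for q
  define l where "l = (\<Sum>n\<in>products k k. \<Sum>a\<in>products k j.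
      coef k k n * coef k j a * ((if a dvd n then real a / real n else 0) / (2 * pi)))"
  have D: "ln (real k) ^ (2 * k) \<le> 4 ^ k * D"
    unfolding D_def using assms by (intro sum_coef_squared_ge) simp
  moreover have "0 < ln (real k) ^ (2 * k)" using assms by simp
  ultimately have "0 < 4 ^ k * D" by linarith
  then have D0: "D > 0" by (simp add: zero_less_mult_iff)
  \<comment> \<open>The index sets do not depend on \<open>q\<close>, so the limit is taken term by
    term.\<close>
  have "(R \<longlongrightarrow> l) (inf sequentially (principal {q. prime q}))"
    unfolding R_def l_def
    by (intro tendsto_sum tendsto_mult_left congruent_weight_tendsto)
      (use products_bounds in fastforce)+
  moreover have "D / (4 * pi) < l"
  proof -
    \<comment> \<open>This strict gap, available since \<open>D > 0\<close>, turns the limit into an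
      eventual inequality; hence \<open>4 * pi\<close> in place of \<open>2 * pi\<close>.\<close>
    have "D / (4 * pi) < D / (2 * pi)" using D0 by (intro divide_strict_left_mono) auto
    also have "\<dots> \<le> l"
    proof -
      have "D \<le> (\<Sum>n\<in>products k k. \<Sum>a\<in>products k j.
          coef k k n * coef k j a * (if a dvd n then real a / real n else 0))"
        using sum_coef_squared_le[of k j] by (simp add: D_def j)
      then have "D / (2 * pi) \<le> (\<Sum>n\<in>products k k. \<Sum>a\<in>products k j.
          coef k k n * coef k j a * (if a dvd n then real a / real n else 0)) / (2 * pi)"
        by (rule divide_right_mono) simp
      also have "\<dots> = l" unfolding l_def sum_divide_distrib by (simp only: times_divide_eq_right)
      finally show ?thesis .
    qed
    finally show ?thesis .
  qed
  ultimately have "eventually (\<lambda>q. D / (4 * pi) < R q) (inf sequentially (principal {q. prime q}))"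
    by (rule order_tendstoD)
  moreover have "eventually (\<lambda>q. k ^ k < q) (inf sequentially (principal {q. prime q}))"
    using filter_leD[OF inf_le1 eventually_gt_at_top] .
  moreover have "eventually prime (inf sequentially (principal {q. prime q}))"
    by (simp add: eventually_inf_principal)
  ultimately show ?thesis
  proof eventually_elim
    case (elim q)
    let ?S = "\<Sum>\<chi>\<in>dirichlet_characters q. norm (cot_sum q \<chi>) ^ (2 * k)"
    have "real (q - 1) * D \<le> (\<Sum>\<chi>\<in>dirichlet_characters q. (4 * pi * norm (cot_sum q \<chi>)) ^ (2 * Suc j))"
      using elim assms by (intro cot_sum_moment_ge[where N = k]) (simp_all add: D_def R_def j)
    also have "\<dots> = (4 * pi) ^ (2 * k) * ?S"
      by (simp only: power_mult_distrib sum_distrib_left j)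
    finally have S: "real (q - 1) * D \<le> (4 * pi) ^ (2 * k) * ?S" .
    \<comment> \<open>The extra factor 2 in \<open>8 * pi\<close> absorbs the bound
      \<open>4 ^ k\<close> for the number of products.\<close>
    have "(8 * pi) ^ (2 * k) = 4 ^ k * (4 * pi) ^ (2 * k)"
    proof -
      have "(8 * pi) ^ (2 * k) = (2 * (4 * pi)) ^ (2 * k)" by simp
      also have "\<dots> = (2 ^ 2) ^ k * (4 * pi) ^ (2 * k)" by (simp only: power_mult_distrib power_mult)
      finally show ?thesis by simp
    qed
    then have "(ln (real k) / (8 * pi)) ^ (2 * k) = ln (real k) ^ (2 * k) / (4 ^ k * (4 * pi) ^ (2 * k))"
      by (simp only: power_divide)
    also have "\<dots> \<le> 4 ^ k * D / (4 ^ k * (4 * pi) ^ (2 * k))"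
      by (rule divide_right_mono[OF D]) simp
    also have "\<dots> = D / (4 * pi) ^ (2 * k)" by simp
    finally have "real (q - 1) * (ln (real k) / (8 * pi)) ^ (2 * k) \<le> real (q - 1) * (D / (4 * pi) ^ (2 * k))"
      by (rule mult_left_mono) simp
    also have "\<dots> \<le> ?S" using S by (simp add: field_simps)
    finally have "real q ^ k * (real (q - 1) * (ln (real k) / (8 * pi)) ^ (2 * k)) \<le> real q ^ k * ?S"
      by (rule mult_left_mono) simp
    also have "\<dots> \<le> (\<Sum>\<chi>\<in>dirichlet_characters q - {principal_character q}. max_char_sum \<chi> ^ (2 * k))"
      using sum_cot_sum_le_sum_max_char_sum[OF elim(3), of k] assms by simp
    finally show ?case by (simp only: mult_ac)
  qed
qed

theorem theorem1p2:
  "\<exists>c :: nat \<Rightarrow> real.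
     (\<exists>(C::real) (E :: nat \<Rightarrow> real). \<forall>k\<ge>2.
        c k = exp (2 * real k * ln (ln (real k)) + E k) \<and> \<bar>E k\<bar> \<le> C * real k) \<and>
     (\<forall>k\<ge>2. \<exists>\<epsilon> :: nat \<Rightarrow> real.
        (\<epsilon> \<longlongrightarrow> 0) (inf sequentially (principal {q. prime q})) \<and>
        (\<forall>q. prime q \<longrightarrow>
          1 / real (totient q) *
            (\<Sum>\<chi> \<in> dirichlet_characters q - {principal_character q}. max_char_sum \<chi> ^ (2 * k))
          \<ge> (c k + \<epsilon> q) * real q ^ k))"
proof -
  define c where "c k = (ln (real k) / (8 * pi)) ^ (2 * k)" for k
  \<comment> \<open>The error term is exactly linear: ln c(k) = 2k ln ln k - 2k ln(8\<pi>), where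
    \<open>k \<ge> 2\<close> makes ln k positive.\<close>
  define E where "E k = - 2 * real k * ln (8 * pi)" for k
  have "c k = exp (2 * real k * ln (ln (real k)) + E k) \<and> \<bar>E k\<bar> \<le> 2 * ln (8 * pi) * real k"
    if "k \<ge> 2" for k
  proof
    have k: "ln (real k) > 0" using that by simp
    have "c k = exp (ln (ln (real k) / (8 * pi))) ^ (2 * k)"
      using k by (simp add: c_def)
    also have "\<dots> = exp (real (2 * k) * ln (ln (real k) / (8 * pi)))"
      by (rule exp_of_nat_mult[symmetric])
    also have "real (2 * k) * ln (ln (real k) / (8 * pi)) = 2 * real k * ln (ln (real k)) + E k"
      using k by (simp add: E_def ln_div right_diff_distrib)
    finally show "c k = exp (2 * real k * ln (ln (real k)) + E k)" .
    have "8 * pi \<ge> 1" using pi_ge_two by simp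
    then have "ln (8 * pi) \<ge> 0" by simp
    then show "\<bar>E k\<bar> \<le> 2 * ln (8 * pi) * real k" by (simp add: E_def abs_mult)
  qed
  moreover have "\<exists>\<epsilon> :: nat \<Rightarrow> real.
      (\<epsilon> \<longlongrightarrow> 0) (inf sequentially (principal {q. prime q})) \<and>
      (\<forall>q. prime q \<longrightarrow>
        1 / real (totient q) *
          (\<Sum>\<chi> \<in> dirichlet_characters q - {principal_character q}. max_char_sum \<chi> ^ (2 * k))
        \<ge> (c k + \<epsilon> q) * real q ^ k)" if k: "k \<ge> 2" for k
  proof -
    let ?M = "\<lambda>q. 1 / real (totient q) *
      (\<Sum>\<chi> \<in> dirichlet_characters q - {principal_character q}. max_char_sum \<chi> ^ (2 * k))"
    \<comment> \<open>The minimum makes the inequality true at every prime, including small ones,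
      and is zero as soon as the bound with \<open>c k\<close> holds.\<close>
    define \<epsilon> where "\<epsilon> q = min 0 (?M q / real q ^ k - c k)" for q
    have "eventually prime (inf sequentially (principal {q::nat. prime q}))"
      by (simp add: eventually_inf_principal)
    with eventually_sum_max_char_sum_ge[OF k]
    have "eventually (\<lambda>q. \<epsilon> q = 0) (inf sequentially (principal {q. prime q}))"
    proof eventually_elim
      case (elim q)
      have q: "q > 1" using elim(2) prime_gt_1_nat by blast
      have "c k = real (q - 1) * real q ^ k * c k / (real (q - 1) * real q ^ k)" using q by simp
      also have "\<dots> \<le> (\<Sum>\<chi> \<in> dirichlet_characters q - {principal_character q}. max_char_sum \<chi> ^ (2 * k)) /
          (real (q - 1) * real q ^ k)"
        using elim(1) unfolding c_def by (rule divide_right_mono) simp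
      also have "\<dots> = ?M q / real q ^ k" using totient_prime[OF elim(2)] by simp
      finally show ?case by (simp add: \<epsilon>_def)
    qed
    then have "(\<epsilon> \<longlongrightarrow> 0) (inf sequentially (principal {q. prime q}))"
      by (rule tendsto_eventually)
    moreover have "(c k + \<epsilon> q) * real q ^ k \<le> ?M q" if "prime q" for q
    proof -
      have "real q ^ k > 0" using that prime_gt_0_nat by simp
      moreover have "c k + \<epsilon> q \<le> ?M q / real q ^ k" by (simp add: \<epsilon>_def)
      ultimately show ?thesis by (simp only: pos_le_divide_eq)
    qed
    ultimately show ?thesis by blast
  qed
  ultimately show ?thesis by blast
qed

end
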